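(* Let $n\ge2$, $\nu>-1$ and $1<p<q\le\infty$. Then $B_q^{0,\nu}(\mathbb{S}^{n-1})\subsetneqq B_p^{0,\nu}(\mathbb{S}^{n-1})$.
   Context: $\mathbb{S}^{n-1}$ is the unit sphere of $\mathbb{R}^n$ and $\sigma$ is the induced Lebesgue (surface) measure; $|M|=\sigma(M)$. Functions are complex-valued and identified when equal a.e. $\log^+t=\max\{\log t,0\}$ for $t>0$. A cap is a set $\{x\in\mathbb{S}^{n-1}:|x-x_0|<\rho\}$ with $x_0\in\mathbb{S}^{n-1}$, $\rho>0$ (an arc when $n=2$). For $1<q\le\infty$ let $1/q+1/q'=1$ (so $q'=1$ if $q=\infty$). A $q$-block is a measurable function $a$ on $\mathbb{S}^{n-1}$ supported in some cap $M$ with $\|a\|_{q}\le |M|^{-1/q'}$. The block space $B_q^{0,\nu}(\mathbb{S}^{n-1})$ is the set of all $\Omega\in L^1(\mathbb{S}^{n-1})$ that can be written as $\Omega=\sum_{j=1}^\infty\mu_ja_j$ (convergence in $L^1$), where $\mu_j\in\mathbb{C}$, each $a_j$ is a $q$-block supported in a cap $M_j$, and $$\sum_{j=1}^\infty|\mu_j|\Big\{1+\Big(\log^+\frac1{|M_j|}\Big)^{1+\nu}\Big\}<\infty.$$ *)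

theory Defs
  imports "HOL-Analysis.Analysis" "HOL-Probability.Essential_Supremum"
begin

text \<open>
  Surface measure on the unit sphere of \<open>\<real>\<^sup>n\<close>, from polar coordinates:
  \<open>\<sigma>(A) = n \<cdot> \<lambda>{t x | 0 < t < 1, x \<in> A}\<close>, where \<open>\<lambda>\<close> is Lebesgue measure.
  The measure space is completed, so that its measurable sets are the Lebesgue
  measurable subsets of the sphere.
\<close>

definition sphere_borel_measure :: "(real ^ 'n) measure" where
  "sphere_borel_measure =
     distr (scale_measure (of_nat CARD('n)) (restrict_space lborel (ball 0 1 - {0})))
           (restrict_space borel (sphere 0 1)) (\<lambda>x. x /\<^sub>R norm x)"

definition sphere_measure :: "(real ^ 'n) measure" where
  "sphere_measure = completion sphere_borel_measure"

lemma radial_projection_measurable: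
  "(\<lambda>x::real ^ 'n. x /\<^sub>R norm x)
     \<in> restrict_space lborel (ball 0 1 - {0}) \<rightarrow>\<^sub>M restrict_space borel (sphere 0 1)"
  by (intro measurable_restrict_space2 measurable_restrict_space1)
     (auto simp: space_restrict_space)

lemma space_sphere_measure: "space (sphere_measure :: (real ^ 'n) measure) = sphere 0 1"
  by (simp add: sphere_measure_def sphere_borel_measure_def space_restrict_space)

lemma emeasure_sphere_measure:
  fixes A :: "(real ^ 'n) set"
  assumes "A \<in> sets borel" "A \<subseteq> sphere 0 1"
  shows "emeasure sphere_measure A =
           of_nat CARD('n) * emeasure lborel {x \<in> ball 0 1 - {0}. x /\<^sub>R norm x \<in> A}"
proof -
  have A: "A \<in> sets (restrict_space borel (sphere 0 1))"
    using assms by (auto simp: sets_restrict_space_iff)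
  have "emeasure sphere_measure A = emeasure sphere_borel_measure A"
    using A by (simp add: sphere_measure_def sphere_borel_measure_def)
  also have "\<dots> = of_nat CARD('n) *
      emeasure (restrict_space lborel (ball 0 1 - {0})) {x \<in> ball 0 1 - {0}. x /\<^sub>R norm x \<in> A}"
  proof -
    have "(\<lambda>x::real ^ 'n. x /\<^sub>R norm x) -` A \<inter> (ball 0 1 - {0})
        = {x \<in> ball 0 1 - {0}. x /\<^sub>R norm x \<in> A}"
      by auto
    moreover have m: "(\<lambda>x::real ^ 'n. x /\<^sub>R norm x)
        \<in> scale_measure (of_nat CARD('n)) (restrict_space lborel (ball 0 1 - {0}))
          \<rightarrow>\<^sub>M restrict_space borel (sphere 0 1)"
      using radial_projection_measurable measurable_cong_sets[OF sets_scale_measure refl] by blast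
    ultimately show ?thesis
      using emeasure_distr[OF m A]
      by (simp add: sphere_borel_measure_def space_restrict_space space_scale_measure)
  qed
  also have "emeasure (restrict_space lborel (ball 0 1 - {0})) {x \<in> ball 0 1 - {0}. x /\<^sub>R norm x \<in> A}
     = emeasure lborel {x \<in> ball 0 1 - {0}. x /\<^sub>R norm x \<in> A}"
    by (rule emeasure_restrict_space) auto
  finally show ?thesis .
qed

definition is_cap :: "(real ^ 'n) set \<Rightarrow> bool" where
  "is_cap M \<longleftrightarrow> (\<exists>x0 \<rho>. x0 \<in> sphere 0 1 \<and> 0 < \<rho> \<and> M = {x \<in> sphere 0 1. norm (x - x0) < \<rho>})"

text \<open>Exponents range over the extended nonnegative reals, where \<open>inverse \<infinity> = 0\<close>.\<close>

definition conjugate_exponent :: "ennreal \<Rightarrow> ennreal" where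
  "conjugate_exponent q = inverse (1 - inverse q)"

lemma conjugate_exponent:
  assumes "1 < q"
  shows "inverse q + inverse (conjugate_exponent q) = 1"
proof (cases q)
  case (real r)
  with assms have r: "1 < r"
    by (metis ennreal_1 ennreal_less_iff zero_le_one)
  then have "1 - inverse q = ennreal (1 - inverse r)"
    using real by (simp add: inverse_ennreal ennreal_minus flip: ennreal_1)
  moreover have "0 < 1 - inverse r" "0 < inverse (1 - inverse r)"
    using r by (auto simp: field_simps)
  ultimately have "inverse (conjugate_exponent q) = ennreal (1 - inverse r)"
    by (simp only: conjugate_exponent_def inverse_ennreal inverse_inverse_eq)
  then show ?thesis
    using real r by (simp add: inverse_ennreal field_simps flip: ennreal_plus)
qed (simp add: conjugate_exponent_def)

definition Lp_norm :: "ennreal \<Rightarrow> 'a measure \<Rightarrow> ('a \<Rightarrow> complex) \<Rightarrow> ennreal" where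
  "Lp_norm q M f =
     (if q = \<infinity> then esssup M (\<lambda>x. ennreal (norm (f x)))
      else let I = (\<integral>\<^sup>+ x. ennreal (norm (f x) powr enn2real q) \<partial>M)
           in if I = \<infinity> then \<infinity> else ennreal (enn2real I powr (1 / enn2real q)))"

text \<open>As functions are identified when they agree almost everywhere, the support condition
  is required almost everywhere.\<close>

definition is_block :: "ennreal \<Rightarrow> (real ^ 'n) set \<Rightarrow> (real ^ 'n \<Rightarrow> complex) \<Rightarrow> bool" where
  "is_block q M a \<longleftrightarrow>
     a \<in> borel_measurable sphere_measure \<and>
     (AE x in sphere_measure. x \<notin> M \<longrightarrow> a x = 0) \<and>
     Lp_norm q sphere_measure a
       \<le> ennreal (measure sphere_measure M powr (- enn2real (inverse (conjugate_exponent q))))"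

definition log_plus :: "real \<Rightarrow> real" where
  "log_plus t = max (ln t) 0"

text \<open>Membership depends only on the values on the sphere, and only up to null sets.\<close>

definition block_space :: "ennreal \<Rightarrow> real \<Rightarrow> (real ^ 'n \<Rightarrow> complex) set" where
  "block_space q \<nu> = {\<Omega>. integrable sphere_measure \<Omega> \<and>
     (\<exists>(\<mu> :: nat \<Rightarrow> complex) a M.
        (\<forall>j. is_cap (M j) \<and> is_block q (M j) (a j)) \<and>
        summable (\<lambda>j. norm (\<mu> j) *
          (1 + log_plus (1 / measure sphere_measure (M j)) powr (1 + \<nu>))) \<and>
        (\<lambda>N. \<integral>\<^sup>+ x. ennreal (norm (\<Omega> x - (\<Sum>j<N. \<mu> j * a j x))) \<partial>sphere_measure)
          \<longlonglongrightarrow> 0)}"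

end

theory Submission
  imports Defs
begin

text \<open>
  Half of a \<open>q\<close>-block is a \<open>p\<close>-block on the same cap, which gives the inclusion. For strictness, take
  sets \<open>E\<^sub>i\<close> with \<open>|E\<^sub>i| \<approx> \<epsilon>\<^sub>i\<close> that have density at most \<open>C \<epsilon>\<^sub>i\<close> in every cap, except for caps so
  small that the logarithmic weight exceeds \<open>\<epsilon>\<^sub>i\<^bsup>-1/q'\<^esup>\<close>. Then the integral over \<open>E\<^sub>i\<close> of any \<open>q\<close>-block is at
  most \<open>C \<epsilon>\<^sub>i\<^bsup>1/q'\<^esup>\<close> times its weight, so a function in the \<open>q\<close>-space has integrals
  \<open>O(\<epsilon>\<^sub>i\<^bsup>1/q'\<^esup>)\<close> over \<open>E\<^sub>i\<close>. The functions \<open>\<epsilon>\<^sub>i\<^bsup>-1/p\<^esup> 1(E\<^sub>i)\<close> are multiples of \<open>p\<close>-blocks on the whole sphere,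
  uniformly in \<open>i\<close>, and their integrals \<open>\<approx> \<epsilon>\<^sub>i\<^bsup>1/p'\<^esup>\<close> are larger than this by the factor
  \<open>\<epsilon>\<^sub>i\<^bsup>1/q-1/p\<^esup>\<close>. If \<open>\<epsilon>\<^sub>i\<close> decreases so fast that this factor is at least \<open>4\<^sup>i\<close>, their sum with weights \<open>2\<^bsup>-i\<^esup>\<close> is in the
  \<open>p\<close>-space but not in the \<open>q\<close>-space.
\<close>

subsection \<open>The surface measure of caps\<close>

definition cap :: "real ^ 'n \<Rightarrow> real \<Rightarrow> (real ^ 'n) set" where
  "cap x0 \<rho> = {x \<in> sphere 0 1. norm (x - x0) < \<rho>}"

lemma cap_subset_sphere: "cap x0 \<rho> \<subseteq> sphere 0 1"
  by (auto simp: cap_def)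

lemma cap_eq_Int_ball: "cap x0 \<rho> = sphere 0 1 \<inter> ball x0 \<rho>"
  by (auto simp: cap_def dist_norm norm_minus_commute)

lemma borel_cap [measurable]: "cap x0 \<rho> \<in> sets borel"
  by (simp add: cap_eq_Int_ball)

section \<open>Measurability and finiteness for the surface measure\<close>

lemma sets_sphere_measure_borel:
  fixes A :: "(real ^ 'n::finite) set"
  assumes "A \<in> sets borel" "A \<subseteq> sphere 0 1"
  shows "A \<in> sets sphere_measure"
  using assms by (auto simp: sphere_measure_def sphere_borel_measure_def sets_restrict_space_iff
      intro!: sets_completionI_sets)

lemma sets_cap: "cap x0 \<rho> \<in> sets sphere_measure"
  by (simp add: sets_sphere_measure_borel cap_subset_sphere)

lemma fmeasurable_ball: "ball (c :: 'a::euclidean_space) r \<in> fmeasurable lborel"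
  by (intro fmeasurableI emeasure_bounded_finite) auto

lemma finite_measure_sphere: "finite_measure (sphere_measure :: (real ^ 'n::finite) measure)"
proof
  have "emeasure lborel {x \<in> ball 0 1 - {0}. x /\<^sub>R norm x \<in> sphere (0::real^'n) 1}
      \<le> emeasure lborel (ball (0::real^'n) 1)"
    by (intro emeasure_mono) auto
  also have "\<dots> < \<infinity>"
    by (rule emeasure_bounded_finite) simp
  finally have "emeasure sphere_measure (sphere (0::real^'n) 1) < \<infinity>"
    by (subst emeasure_sphere_measure) (auto simp: ennreal_mult_less_top of_nat_less_top)
  then show "emeasure (sphere_measure :: (real ^ 'n) measure) (space sphere_measure) \<noteq> \<infinity>"
    by (simp add: space_sphere_measure)
qed

interpretation sphere: finite_measure "sphere_measure :: (real ^ 'n::finite) measure"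
  by (rule finite_measure_sphere)

text \<open>The open cone over \<open>A\<close> inside the unit ball, without its apex. Its volume
  times n is the surface measure of \<open>A\<close>, so estimates on the sphere become volume
  estimates.\<close>

definition sector :: "(real ^ 'n) set \<Rightarrow> (real ^ 'n) set" where
  "sector A = {x \<in> ball 0 1 - {0}. x /\<^sub>R norm x \<in> A}"

lemma sector_fmeasurable:
  fixes A :: "(real ^ 'n::finite) set"
  assumes "A \<in> sets borel"
  shows "sector A \<in> fmeasurable lborel"
proof -
  have "(\<lambda>x::real^'n. x /\<^sub>R norm x) \<in> borel_measurable borel"
    by measurable
  then have "(\<lambda>x::real^'n. x /\<^sub>R norm x) -` A \<in> sets borel"
    using assms measurable_sets_borel by blast
  moreover have "sector A = (\<lambda>x::real^'n. x /\<^sub>R norm x) -` A \<inter> (ball 0 1 - {0})"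
    by (auto simp: sector_def)
  ultimately have "sector A \<in> sets borel" by auto
  moreover have "sector A \<subseteq> ball 0 1" by (auto simp: sector_def)
  ultimately show ?thesis
    by (intro fmeasurableI2[OF fmeasurable_ball]) auto
qed

lemma measure_sphere_measure:
  fixes A :: "(real ^ 'n::finite) set"
  assumes "A \<in> sets borel" "A \<subseteq> sphere 0 1"
  shows "measure sphere_measure A = CARD('n) * measure lborel (sector A)"
  using emeasure_sphere_measure[OF assms]
  by (simp add: measure_def sector_def enn2real_mult)

section \<open>Two-sided bounds for the measure of a cap\<close>

lemma measure_lborel_ball:
  fixes c :: "real ^ 'n::finite"
  assumes "0 \<le> r"
  shows "measure lborel (ball c r) = unit_ball_vol CARD('n) * r ^ CARD('n)"
  using content_ball[OF assms, of c] by simp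

text \<open>The sector over a cap of radius \<open>\<rho>\<close> is covered by \<open>O(1 / \<rho>)\<close> balls of radius \<open>2 * \<rho>\<close> centred on its
  axis, and contains about \<open>1 / \<rho>\<close> disjoint balls of radius \<open>\<rho> / 16\<close> centred there.\<close>

lemma cap_measure_upper:
  fixes x0 :: "real ^ 'n::finite"
  assumes "norm x0 = 1" "0 < \<rho>" "\<rho> \<le> 9"
  shows "measure sphere_measure (cap x0 \<rho>)
    \<le> (CARD('n) * unit_ball_vol CARD('n) * 10 * 2 ^ CARD('n)) * \<rho> ^ (CARD('n) - 1)"
proof -
  \<comment> \<open>With this many steps every number in [0,1) exceeds some
    \<open>k * \<rho>\<close> with \<open>k < m\<close> by less than \<open>\<rho>\<close>, or
    equals it.\<close>
  define m where "m = nat \<lceil>1/\<rho>\<rceil>"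
  have m: "real m \<le> 10/\<rho>"
  proof -
    have "real m \<le> 1/\<rho> + 1"
      using assms of_int_ceiling_le_add_one[of "1/\<rho>"] by (simp add: m_def)
    \<comment> \<open>Equivalent to \<open>\<rho> \<le> 9\<close>.\<close>
    also have "\<dots> \<le> 10/\<rho>" using assms by (simp add: field_simps)
    finally show ?thesis .
  qed
  have "sector (cap x0 \<rho>) \<subseteq> (\<Union>k\<in>{..<m}. ball ((real k * \<rho>) *\<^sub>R x0) (2*\<rho>))"
  proof
    fix y assume "y \<in> sector (cap x0 \<rho>)"
    then have y: "y \<noteq> 0" "norm y < 1" "norm (y /\<^sub>R norm y - x0) < \<rho>"
      by (auto simp: sector_def cap_def)
    define k where "k = nat \<lfloor>norm y / \<rho>\<rfloor>"
    have k: "real k \<le> norm y / \<rho>" "norm y / \<rho> < real k + 1"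
      using assms unfolding k_def by (auto simp: of_nat_nat)
    have "norm y / \<rho> < 1/\<rho>" using y assms by (simp add: field_simps)
    then have "k < m"
      using k(1) assms unfolding m_def by (smt (verit) of_nat_less_iff real_nat_ceiling_ge)
    \<comment> \<open>Passes through the axis point \<open>norm y *\<^sub>R x0\<close>: the cap
      condition puts \<open>y\<close> within \<open>\<rho>\<close> of it, and rounding puts it
      within \<open>\<rho>\<close> of the centre.\<close>
    have "y - (real k * \<rho>) *\<^sub>R x0 = norm y *\<^sub>R (y /\<^sub>R norm y - x0) + (norm y - k * \<rho>) *\<^sub>R x0"
      using y by (simp add: algebra_simps)
    then have "norm (y - (real k * \<rho>) *\<^sub>R x0)
        \<le> norm y * norm (y /\<^sub>R norm y - x0) + \<bar>norm y - k * \<rho>\<bar> * norm x0"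
      by (metis norm_triangle_ineq norm_scaleR abs_norm_cancel)
    also have "\<bar>norm y - k * \<rho>\<bar> * norm x0 \<le> \<rho>"
      using k assms by (simp add: field_simps abs_le_iff)
    also have "norm y * norm (y /\<^sub>R norm y - x0) < 1 * \<rho>"
      using y by (intro mult_strict_mono) auto
    finally have "norm (y - (real k * \<rho>) *\<^sub>R x0) < 2*\<rho>" by simp
    then show "y \<in> (\<Union>k\<in>{..<m}. ball ((real k * \<rho>) *\<^sub>R x0) (2*\<rho>))"
      using \<open>k < m\<close> by (auto simp: dist_norm norm_minus_commute)
  qed
  then have "measure lborel (sector (cap x0 \<rho>))
      \<le> measure lborel (\<Union>k\<in>{..<m}. ball ((real k * \<rho>) *\<^sub>R x0) (2*\<rho>))"
    using sector_fmeasurable[OF borel_cap[of x0 \<rho>]]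
    by (intro measure_mono_fmeasurable fmeasurable.finite_UN fmeasurable_ball) auto
  also have "\<dots> \<le> (\<Sum>k<m. measure lborel (ball ((real k * \<rho>) *\<^sub>R x0) (2*\<rho>)))"
    by (rule measure_UNION_le) auto
  also have "\<dots> = m * (unit_ball_vol CARD('n) * (2 * \<rho>) ^ CARD('n))"
    using assms by (simp add: measure_lborel_ball)
  also have "\<dots> \<le> 10/\<rho> * (unit_ball_vol CARD('n) * (2 * \<rho>) ^ CARD('n))"
    using m assms by (intro mult_right_mono) auto
  also have "\<dots> = (unit_ball_vol CARD('n) * 10 * 2 ^ CARD('n)) * \<rho> ^ (CARD('n) - 1)"
    using assms by (simp add: power_mult_distrib field_simps flip: power_Suc)
  finally show ?thesis
    by (simp add: measure_sphere_measure cap_subset_sphere mult_left_mono mult.assoc)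
qed

lemma cap_measure_lower:
  fixes x0 :: "real ^ 'n::finite"
  assumes "norm x0 = 1" "0 < \<rho>" "\<rho> \<le> 4"
  shows "CARD('n) * unit_ball_vol CARD('n) / (8 * 16 ^ (CARD('n) - 1)) * \<rho> ^ (CARD('n) - 1)
    \<le> measure sphere_measure (cap x0 \<rho>)"
proof -
  \<comment> \<open>In a ball of radius \<open>\<eta>\<close> around an axis point, lying beyond
    distance 1/2 from the origin, directions differ from \<open>x0\<close> by less than
    \<open>4 * \<eta>\<close>, which is below \<open>\<rho>\<close>. The divisor 16 also gives
    \<open>\<eta> \<le> 1/4\<close>, so at least one ball fits.\<close>
  define \<eta> where "\<eta> = \<rho> / 16"
  have \<eta>: "0 < \<eta>" "\<eta> \<le> 1/4" using assms by (auto simp: \<eta>_def)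
  define m where "m = nat \<lfloor>1/(4*\<eta>)\<rfloor>"
  have x: "1 \<le> 1/(4*\<eta>)" using \<eta> by (simp add: field_simps)
  have m: "real m \<le> 1/(4*\<eta>)" "1/(8*\<eta>) \<le> real m"
  proof -
    show "real m \<le> 1/(4*\<eta>)" using x of_nat_floor[of "1/(4*\<eta>)"] unfolding m_def by (meson order_trans zero_le_one)
    \<comment> \<open>Rounding down loses at most half of a number \<open>z\<close> that is at least
      1: for \<open>z\<close> up to 2 use the bound 1, beyond that use \<open>z - 1\<close>.\<close>
    have "1/(4*\<eta>) - 1 < real m" "1 \<le> real m"
      using x real_of_int_floor_gt_diff_one[of "1/(4*\<eta>)"] floor_mono[OF x] by (simp_all add: m_def) linarith+
    moreover have "z / 2 \<le> real m" if "z - 1 < real m" "1 \<le> real m" for z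
      using that by linarith
    ultimately have "1/(4*\<eta>) / 2 \<le> real m" by blast
    then show "1/(8*\<eta>) \<le> real m" by simp
  qed
  have m2: "4 * \<eta> * real m \<le> 1" using m(1) \<eta> by (simp add: field_simps)
  \<comment> \<open>Spacing \<open>2 * \<eta>\<close> keeps the open balls disjoint. The first one
    starts at distance 1/2 from the origin, and \<open>m2\<close> keeps the last one inside the unit
    ball.\<close>
  define s where "s k = 1/2 + (2 * real k + 1) * \<eta>" for k
  have s: "1/2 \<le> s k - \<eta>" "s k + \<eta> \<le> 1" if "k < m" for k
  proof -
    have "2 * real k + 2 \<le> 2 * real m" using that by linarith
    then have "(2 * real k + 2) * \<eta> \<le> 2 * real m * \<eta>" using \<eta> by (intro mult_right_mono) auto
    also have "\<dots> \<le> 1/2" using m2 by (simp add: field_simps)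
    finally show "s k + \<eta> \<le> 1" by (simp add: s_def algebra_simps)
    show "1/2 \<le> s k - \<eta>" using \<eta> by (simp add: s_def algebra_simps)
  qed
  have sub: "(\<Union>k\<in>{..<m}. ball (s k *\<^sub>R x0) \<eta>) \<subseteq> sector (cap x0 \<rho>)"
  proof clarify
    fix k y assume k: "k < m" "y \<in> ball (s k *\<^sub>R x0) \<eta>"
    then have d: "norm (y - s k *\<^sub>R x0) < \<eta>" by (simp add: dist_norm norm_minus_commute)
    have "s k > 0" using s[OF k(1)] \<eta> by linarith
    then have ns: "norm (s k *\<^sub>R x0) = s k" using assms by simp
    have ny: "\<bar>norm y - s k\<bar> < \<eta>"
      using d norm_triangle_ineq3[of y "s k *\<^sub>R x0"] ns by simp
    then have y: "1/2 < norm y" "norm y < 1" using s[OF k(1)] by linarith+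
    have "norm y *\<^sub>R (y /\<^sub>R norm y - x0) = (y - s k *\<^sub>R x0) + (s k - norm y) *\<^sub>R x0"
      using y by (cases "y = 0") (simp_all add: algebra_simps)
    then have "norm y * norm (y /\<^sub>R norm y - x0) \<le> norm (y - s k *\<^sub>R x0) + \<bar>s k - norm y\<bar> * norm x0"
      by (metis norm_triangle_ineq norm_scaleR abs_norm_cancel)
    also have "\<dots> < 2 * \<eta>" using d ny assms by simp
    finally have "norm y * norm (y /\<^sub>R norm y - x0) < 2 * \<eta>" .
    moreover have "1/2 * norm (y /\<^sub>R norm y - x0) \<le> norm y * norm (y /\<^sub>R norm y - x0)"
      using y by (intro mult_right_mono) auto
    ultimately have "norm (y /\<^sub>R norm y - x0) < \<rho>" using \<eta>_def assms by linarith
    then show "y \<in> sector (cap x0 \<rho>)" using y by (cases "y = 0") (auto simp: sector_def cap_def)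
  qed
  have disj: "disjoint_family_on (\<lambda>k. ball (s k *\<^sub>R x0) \<eta>) {..<m}"
  proof (clarsimp simp: disjoint_family_on_def)
    fix j k :: nat assume "j \<noteq> k"
    then have "1 \<le> \<bar>real j - real k\<bar>" by linarith
    then have "2 * \<eta> \<le> \<bar>real j - real k\<bar> * (2 * \<eta>)" using \<eta> by simp
    also have "\<dots> = \<bar>s j - s k\<bar>"
      using \<eta> by (simp add: s_def abs_mult flip: left_diff_distrib) (simp add: abs_if algebra_simps)
    also have "\<dots> = dist (s j *\<^sub>R x0) (s k *\<^sub>R x0)"
      using assms by (simp add: dist_norm flip: scaleR_left_diff_distrib)
    finally show "ball (s j *\<^sub>R x0) \<eta> \<inter> ball (s k *\<^sub>R x0) \<eta> = {}"
      by (intro disjoint_ballI) simp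
  qed
  have "unit_ball_vol CARD('n) / (8 * 16 ^ (CARD('n) - 1)) * \<rho> ^ (CARD('n) - 1)
      = 1/(8*\<eta>) * (unit_ball_vol CARD('n) * \<eta> ^ CARD('n))"
  proof -
    have "\<rho> = 16 * \<eta>" by (simp add: \<eta>_def)
    moreover have "\<eta> ^ CARD('n) = \<eta> * \<eta> ^ (CARD('n) - 1)" by (simp flip: power_Suc)
    ultimately show ?thesis using \<eta> by (simp add: power_mult_distrib)
  qed
  also have "\<dots> \<le> m * (unit_ball_vol CARD('n) * \<eta> ^ CARD('n))"
    using m \<eta> by (intro mult_right_mono) auto
  also have "\<dots> = (\<Sum>k<m. measure lborel (ball (s k *\<^sub>R x0) \<eta>))"
    using \<eta> by (simp add: measure_lborel_ball)
  also have "\<dots> = measure lborel (\<Union>k\<in>{..<m}. ball (s k *\<^sub>R x0) \<eta>)"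
    using disj fmeasurable_ball
    by (intro measure_finite_Union[symmetric]) (auto simp: fmeasurable_def less_top)
  also have "\<dots> \<le> measure lborel (sector (cap x0 \<rho>))"
    using sub by (intro measure_mono_fmeasurable sector_fmeasurable) auto
  finally have "CARD('n) * (unit_ball_vol CARD('n) / (8 * 16 ^ (CARD('n) - 1)) * \<rho> ^ (CARD('n) - 1))
      \<le> CARD('n) * measure lborel (sector (cap x0 \<rho>))"
    by (intro mult_left_mono) auto
  then show ?thesis
    by (simp add: measure_sphere_measure cap_subset_sphere)
qed


text \<open>From here on only the order n - 1 in the radius matters. The ranges leave room for the
  radius 3, which already gives the whole sphere, and for its threefold enlargement 9.\<close>

lemma cap_measure_bounds:
  obtains c C :: real where "0 < c" "0 < C"
    "\<And>x0 :: real ^ 'n::finite. \<And>\<rho>. norm x0 = 1 \<Longrightarrow> 0 < \<rho> \<Longrightarrow> \<rho> \<le> 4 \<Longrightarrow>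
       c * \<rho> ^ (CARD('n) - 1) \<le> measure sphere_measure (cap x0 \<rho>)"
    "\<And>x0 :: real ^ 'n. \<And>\<rho>. norm x0 = 1 \<Longrightarrow> 0 < \<rho> \<Longrightarrow> \<rho> \<le> 9 \<Longrightarrow>
       measure sphere_measure (cap x0 \<rho>) \<le> C * \<rho> ^ (CARD('n) - 1)"
  by (rule that[of "CARD('n) * unit_ball_vol CARD('n) / (8 * 16 ^ (CARD('n) - 1))"
        "CARD('n) * unit_ball_vol CARD('n) * 10 * 2 ^ CARD('n)"])
    (use cap_measure_lower cap_measure_upper in \<open>auto simp del: times_divide_eq_left\<close>)

subsection \<open>Evenly spread sets\<close>

text \<open>By total boundedness finitely many balls of radius \<open>r/2\<close> cover
  \<open>S\<close>, and each contains at most one point of a separated set. So a separated set of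
  largest cardinality exists, and a point far from all of it could be added.\<close>

lemma ex_maximal_separated:
  fixes S :: "'a :: metric_space set"
  assumes "compact S" "0 < r"
  obtains X where "finite X" "X \<subseteq> S"
    "\<And>x y. x \<in> X \<Longrightarrow> y \<in> X \<Longrightarrow> x \<noteq> y \<Longrightarrow> r \<le> dist x y"
    "\<And>y. y \<in> S \<Longrightarrow> \<exists>x\<in>X. dist x y < r"
proof -
  define sep where "sep X \<longleftrightarrow> finite X \<and> X \<subseteq> S \<and> (\<forall>x\<in>X. \<forall>y\<in>X. x \<noteq> y \<longrightarrow> r \<le> dist x y)" for X
  obtain K where K: "finite K" "S \<subseteq> (\<Union>k\<in>K. ball k (r/2))"
    using assms unfolding compact_eq_totally_bounded by (meson half_gt_zero)
  have bound: "card X \<le> card K" if "sep X" for X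
  proof -
    have "\<forall>x\<in>X. \<exists>k\<in>K. dist k x < r/2"
      using that K(2) by (force simp: sep_def)
    then obtain g where g: "\<And>x. x \<in> X \<Longrightarrow> g x \<in> K \<and> dist (g x) x < r/2"
      by metis
    have "inj_on g X"
    proof (rule inj_onI, rule ccontr)
      fix x y assume xy: "x \<in> X" "y \<in> X" "g x = g y" "x \<noteq> y"
      then have "dist x y < r"
        using g[of x] g[of y] dist_triangle_half_r[of "g x" x r y] by metis
      then show False using that xy by (force simp: sep_def)
    qed
    then show ?thesis
      using g K(1) by (intro card_inj_on_le[of g]) auto
  qed
  have "sep {}" by (simp add: sep_def)
  then obtain X where X: "sep X" "\<And>Y. sep Y \<Longrightarrow> card Y \<le> card X"
    using ex_has_greatest_nat[of sep "{}" card "Suc (card K)"] bound by (metis le_imp_less_Suc less_imp_le)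
  show ?thesis
  proof (rule that[of X])
    show "finite X" "X \<subseteq> S" "\<And>x y. x \<in> X \<Longrightarrow> y \<in> X \<Longrightarrow> x \<noteq> y \<Longrightarrow> r \<le> dist x y"
      using X(1) by (auto simp: sep_def)
    fix y assume y: "y \<in> S"
    show "\<exists>x\<in>X. dist x y < r"
    proof (rule ccontr)
      assume "\<not> ?thesis"
      then have far: "\<And>x. x \<in> X \<Longrightarrow> r \<le> dist x y" by (meson not_less)
      then have "y \<notin> X" using assms(2) by force
      moreover have "sep (insert y X)"
        using X(1) y far by (auto simp: sep_def dist_commute)
      ultimately show False
        using X(2)[of "insert y X"] X(1) by (simp add: sep_def)
    qed
  qed
qed

lemma disjoint_caps:
  fixes X :: "(real ^ 'n::finite) set"
  assumes "\<And>x y. x \<in> X \<Longrightarrow> y \<in> X \<Longrightarrow> x \<noteq> y \<Longrightarrow> r \<le> dist x y" "2 * s \<le> r"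
  shows "disjoint_family_on (\<lambda>x. cap x s) X"
proof -
  have "ball x s \<inter> ball y s = {}" if "x \<in> X" "y \<in> X" "x \<noteq> y" for x y
    using assms(1)[OF that] assms(2) by (intro disjoint_ballI) auto
  then show ?thesis by (auto simp: disjoint_family_on_def cap_eq_Int_ball)
qed

lemma cap_eq_sphere:
  fixes x0 :: "real ^ 'n::finite"
  assumes "norm x0 = 1" "2 < \<rho>"
  shows "cap x0 \<rho> = sphere 0 1"
proof -
  have "norm (x - x0) < \<rho>" if "norm x = 1" for x
    using norm_triangle_ineq4[of x x0] assms that by linarith
  then show ?thesis by (auto simp: cap_def)
qed

text \<open>The sphere has diameter 2, so a larger radius can be lowered to 3 without changing the
  cap. This brings every cap into the range of \<open>cap_measure_bounds\<close>.\<close>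

lemma is_cap_radius_le:
  fixes M :: "(real ^ 'n::finite) set"
  assumes "is_cap M"
  obtains x0 \<rho> where "norm x0 = 1" "0 < \<rho>" "\<rho> \<le> 3" "M = cap x0 \<rho>"
proof -
  obtain x0 \<rho> where *: "norm x0 = 1" "0 < \<rho>" "M = cap x0 \<rho>"
    using assms by (auto simp: is_cap_def cap_def)
  show ?thesis
  proof (cases "\<rho> \<le> 3")
    case False
    then show ?thesis using * that[of x0 3] by (simp add: cap_eq_sphere)
  qed (use * that in blast)
qed

text \<open>A union of caps of radius \<open>t * r\<close> around a maximal \<open>r\<close>-separated set has density
  comparable to \<open>t ^ (n - 1)\<close> in every cap of radius at least \<open>r\<close>.\<close>

lemma ex_evenly_spread_set:
  assumes "2 \<le> CARD('n::finite)"
  obtains c C :: real where "0 < c" "0 < C"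
    "\<And>t \<delta>. 0 < t \<Longrightarrow> t \<le> 1/2 \<Longrightarrow> 0 < \<delta> \<Longrightarrow>
      \<exists>E :: (real ^ 'n) set. E \<in> sets sphere_measure \<and> E \<subseteq> sphere 0 1 \<and>
         c * t ^ (CARD('n) - 1) \<le> measure sphere_measure E \<and>
         (\<forall>M. is_cap M \<longrightarrow> measure sphere_measure M < \<delta> \<or>
            measure sphere_measure (E \<inter> M) \<le> C * t ^ (CARD('n) - 1) * measure sphere_measure M)"
proof -
  let ?n = "CARD('n) - 1"
  let ?\<sigma> = "measure (sphere_measure :: (real ^ 'n) measure)"
  obtain c C :: real where c: "0 < c" and C: "0 < C"
    and lower: "\<And>x0 :: real ^ 'n. \<And>\<rho>. norm x0 = 1 \<Longrightarrow> 0 < \<rho> \<Longrightarrow> \<rho> \<le> 4 \<Longrightarrow> c * \<rho> ^ ?n \<le> ?\<sigma> (cap x0 \<rho>)"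
    and upper: "\<And>x0 :: real ^ 'n. \<And>\<rho>. norm x0 = 1 \<Longrightarrow> 0 < \<rho> \<Longrightarrow> \<rho> \<le> 9 \<Longrightarrow> ?\<sigma> (cap x0 \<rho>) \<le> C * \<rho> ^ ?n"
    using cap_measure_bounds[where 'n='n] by blast
  show ?thesis
  proof (rule that[of "c * c / C" "C * C * 6 ^ ?n / (c * c)"])
    show "0 < c * c / C" "0 < C * C * 6 ^ ?n / (c * c)" using c C by auto
    fix t \<delta> :: real assume t: "0 < t" "t \<le> 1/2" and \<delta>: "0 < \<delta>"
    \<comment> \<open>Makes every cap of radius at most \<open>r\<close> have measure below
      \<open>\<delta>\<close>, using \<open>r ^ (n - 1) \<le> r\<close> for n at least 2 and
      \<open>r \<le> 1\<close>.\<close>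
    define r where "r = min 1 (\<delta> / (2 * C))"
    have r: "0 < r" "r \<le> 1" using \<delta> C by (auto simp: r_def)
    have "r ^ ?n \<le> r ^ 1" using r assms by (intro power_decreasing) auto
    also have "\<dots> \<le> \<delta> / (2 * C)" by (simp add: r_def)
    finally have "C * r ^ ?n \<le> \<delta> / 2" using C by (simp add: field_simps)
    then have r\<delta>: "C * r ^ ?n < \<delta>" using \<delta> by linarith
    obtain X :: "(real ^ 'n) set" where X: "finite X" "X \<subseteq> sphere 0 1"
      and sep: "\<And>x y. x \<in> X \<Longrightarrow> y \<in> X \<Longrightarrow> x \<noteq> y \<Longrightarrow> r \<le> dist x y"
      and net: "\<And>y. y \<in> sphere 0 1 \<Longrightarrow> \<exists>x\<in>X. dist x y < r"
      using ex_maximal_separated[OF compact_sphere r(1)] by metis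
    have X1: "norm x = 1" if "x \<in> X" for x using X(2) that by auto
    define E where "E = (\<Union>x\<in>X. cap x (t * r))"
    have tr: "0 < t * r" "2 * (t * r) \<le> r" "t * r \<le> 1"
      using t r mult_mono[of t "1/2" r r] mult_mono[of t 1 r 1] by auto
    have "c * c / C * t ^ ?n \<le> ?\<sigma> E"
    proof -
      obtain e :: "real ^ 'n" where e: "norm e = 1" using vector_choose_size[of 1] by auto
      \<comment> \<open>The caps of radius \<open>r\<close> around the net cover the sphere, which
        bounds \<open>card X * r ^ (n - 1)\<close> from below. The disjoint caps of radius
        \<open>t * r\<close> keep the fraction \<open>t ^ (n - 1)\<close> of this, up to
        constants.\<close>
      have "c \<le> c * 3 ^ ?n" using c by simp
      also have "\<dots> \<le> ?\<sigma> (cap e 3)" using lower[OF e, of 3] by simp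
      also have "cap e 3 = (\<Union>x\<in>X. cap x r)"
        using net by (subst cap_eq_sphere[OF e]) (auto simp: cap_eq_Int_ball)
      also have "?\<sigma> \<dots> \<le> (\<Sum>x\<in>X. ?\<sigma> (cap x r))"
        using X sets_cap by (intro measure_UNION_le) auto
      also have "\<dots> \<le> (\<Sum>x\<in>X. C * r ^ ?n)"
        using upper[OF X1] r by (intro sum_mono) auto
      finally have "c / C \<le> card X * r ^ ?n" using C by (simp add: field_simps)
      then have "c * t ^ ?n * (c / C) \<le> c * t ^ ?n * (card X * r ^ ?n)"
        using c t by (intro mult_left_mono) auto
      also have "\<dots> = (\<Sum>x\<in>X. c * (t * r) ^ ?n)" by (simp add: power_mult_distrib)
      also have "\<dots> \<le> (\<Sum>x\<in>X. ?\<sigma> (cap x (t * r)))"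
        using lower[OF X1] tr by (intro sum_mono) auto
      also have "\<dots> = ?\<sigma> E"
        unfolding E_def using X sets_cap disjoint_caps[OF sep tr(2)]
        by (intro sphere.finite_measure_finite_Union[symmetric]) auto
      finally show ?thesis by (simp add: field_simps)
    qed
    moreover have "?\<sigma> M < \<delta> \<or> ?\<sigma> (E \<inter> M) \<le> C * C * 6 ^ ?n / (c * c) * t ^ ?n * ?\<sigma> M" if M: "is_cap M" for M
    proof -
      obtain x0 \<rho> where x0: "norm x0 = 1" and \<rho>: "0 < \<rho>" "\<rho> \<le> 3" and Meq: "M = cap x0 \<rho>"
        using is_cap_radius_le[OF M] .
      show ?thesis
      proof (cases "\<rho> < r")
        case True
        then have "M \<subseteq> cap x0 r" by (auto simp: Meq cap_def)
        then have "?\<sigma> M \<le> ?\<sigma> (cap x0 r)"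
          by (intro sphere.finite_measure_mono sets_cap)
        then show ?thesis using upper[OF x0, of r] r r\<delta> by auto
      next
        case False
        \<comment> \<open>Net points whose small caps meet \<open>M\<close>. Since
          \<open>r \<le> \<rho>\<close>, the disjoint caps of radius \<open>r/2\<close> around them
          lie in the cap of radius \<open>3 * \<rho>\<close>, and comparing measures bounds their
          number.\<close>
        define Y where "Y = {x\<in>X. cap x (t * r) \<inter> M \<noteq> {}}"
        have Y: "finite Y" "Y \<subseteq> X" using X by (auto simp: Y_def)
        have "card Y * (c * (r/2) ^ ?n) = (\<Sum>x\<in>Y. c * (r/2) ^ ?n)" by simp
        also have "\<dots> \<le> (\<Sum>x\<in>Y. ?\<sigma> (cap x (r/2)))"
          using lower[OF X1] Y r by (intro sum_mono) auto
        also have "\<dots> = ?\<sigma> (\<Union>x\<in>Y. cap x (r/2))"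
          using Y sets_cap disjoint_family_on_mono[OF Y(2) disjoint_caps[of X r "r/2", OF sep]]
          by (intro sphere.finite_measure_finite_Union[symmetric]) auto
        also have "\<dots> \<le> ?\<sigma> (cap x0 (3 * \<rho>))"
        proof (intro sphere.finite_measure_mono sets_cap UN_least subsetI)
          fix x y assume "x \<in> Y" and y: "y \<in> cap x (r/2)"
          then obtain z where "norm (z - x) < t * r" "norm (z - x0) < \<rho>"
            by (auto simp: Y_def Meq cap_def)
          moreover have "norm (y - x) < r/2" using y by (simp add: cap_def)
          moreover have "norm (y - x0) \<le> norm (y - x) + norm (z - x) + norm (z - x0)"
            by norm
          ultimately have "norm (y - x0) < 3 * \<rho>" using tr False r by linarith
          then show "y \<in> cap x0 (3 * \<rho>)" using y by (simp add: cap_def)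
        qed
        also have "\<dots> \<le> C * (3 * \<rho>) ^ ?n" using upper[OF x0, of "3 * \<rho>"] \<rho> by auto
        finally have "card Y * (c * (r/2) ^ ?n) * 2 ^ ?n \<le> C * (3 * \<rho>) ^ ?n * 2 ^ ?n"
          by (intro mult_right_mono) auto
        also have "C * (3 * \<rho>) ^ ?n * 2 ^ ?n = C * 6 ^ ?n * \<rho> ^ ?n"
        proof -
          have "(3 * \<rho>) ^ ?n * 2 ^ ?n = (6 * \<rho>) ^ ?n" by (simp only: power_mult_distrib[symmetric]) simp
          then show ?thesis by (simp add: power_mult_distrib)
        qed
        also have "\<dots> \<le> C * 6 ^ ?n * (?\<sigma> M / c)"
          using lower[OF x0 \<rho>(1)] \<rho> C c unfolding Meq
          by (intro mult_left_mono) (auto simp: field_simps)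
        finally have count: "card Y * r ^ ?n \<le> C * 6 ^ ?n / (c * c) * ?\<sigma> M"
          using c by (simp add: power_divide field_simps)
        have "?\<sigma> (E \<inter> M) \<le> ?\<sigma> (\<Union>x\<in>Y. cap x (t * r))"
          using Y sets_cap by (intro sphere.finite_measure_mono) (auto simp: E_def Y_def)
        also have "\<dots> \<le> (\<Sum>x\<in>Y. ?\<sigma> (cap x (t * r)))"
          using Y sets_cap by (intro measure_UNION_le) auto
        also have "\<dots> \<le> (\<Sum>x\<in>Y. C * (t * r) ^ ?n)"
          using upper[OF X1] Y tr by (intro sum_mono) auto
        also have "\<dots> = C * t ^ ?n * (card Y * r ^ ?n)"
          by (simp add: power_mult_distrib)
        also have "\<dots> \<le> C * t ^ ?n * (C * 6 ^ ?n / (c * c) * ?\<sigma> M)"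
          using count C t by (intro mult_left_mono) auto
        finally show ?thesis by (simp add: field_simps)
      qed
    qed
    moreover have "E \<in> sets sphere_measure" "E \<subseteq> sphere 0 1"
      unfolding E_def using X sets_cap by (blast, auto simp: cap_def)
    ultimately show "\<exists>E :: (real ^ 'n) set. E \<in> sets sphere_measure \<and> E \<subseteq> sphere 0 1 \<and>
         c * c / C * t ^ ?n \<le> ?\<sigma> E \<and>
         (\<forall>M. is_cap M \<longrightarrow> ?\<sigma> M < \<delta> \<or> ?\<sigma> (E \<inter> M) \<le> C * C * 6 ^ ?n / (c * c) * t ^ ?n * ?\<sigma> M)"
      by blast
  qed
qed


section \<open>Caps as supports of blocks\<close>

lemma measure_cap_pos:
  fixes M :: "(real ^ 'n::finite) set"
  assumes "is_cap M"
  shows "0 < measure sphere_measure M"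
proof -
  obtain x0 \<rho> where *: "norm x0 = 1" "0 < \<rho>" "\<rho> \<le> 3" "M = cap x0 \<rho>"
    using is_cap_radius_le[OF assms] .
  have "0 < CARD('n) * unit_ball_vol CARD('n) / (8 * 16 ^ (CARD('n) - 1)) * \<rho> ^ (CARD('n) - 1)"
    using * by simp
  also have "\<dots> \<le> measure sphere_measure M"
    using * cap_measure_lower[of x0 \<rho>] by simp
  finally show ?thesis .
qed

lemma sets_is_cap: "is_cap M \<Longrightarrow> M \<in> sets sphere_measure"
  using is_cap_radius_le sets_cap by metis

text \<open>Allows the counterexample to use blocks on one cap only, the whole sphere.\<close>

lemma is_cap_sphere: "is_cap (sphere 0 1 :: (real ^ 'n::finite) set)"
proof -
  obtain e :: "real ^ 'n" where e: "norm e = 1" using vector_choose_size[of 1] by auto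
  show ?thesis
    using cap_eq_sphere[OF e, of 3] e unfolding is_cap_def cap_def
    by (intro exI[of _ e] exI[of _ 3]) auto
qed

subsection \<open>Integrals of blocks and inclusion of block spaces\<close>

lemma ex_real_exponent:
  fixes p q :: ennreal
  assumes "1 < p" "p < q"
  obtains P where "p = ennreal P" "1 < P"
proof (cases p)
  case (real P)
  then have "1 < P" using assms(1) by (metis ennreal_1 ennreal_less_iff zero_le_one)
  then show ?thesis using real that by blast
next
  case top
  then show ?thesis using assms(2) by simp
qed

text \<open>A finite bound excludes the infinite branch of \<open>Lp_norm\<close>, so
  \<open>enn2real\<close>, which sends infinity to 0, loses nothing.\<close>

lemma Lp_norm_leD:
  assumes "0 < p" "0 \<le> K" "Lp_norm (ennreal p) M f \<le> ennreal K"
  shows "(\<integral>\<^sup>+ x. ennreal (norm (f x) powr p) \<partial>M) \<le> ennreal (K powr p)"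
proof -
  let ?I = "\<integral>\<^sup>+ x. ennreal (norm (f x) powr p) \<partial>M"
  have fin: "?I \<noteq> \<infinity>" and le: "enn2real ?I powr (1 / p) \<le> K"
    using assms by (auto simp: Lp_norm_def Let_def top_unique split: if_splits)
  have "enn2real ?I = (enn2real ?I powr (1 / p)) powr p"
    using assms by (simp add: powr_powr)
  also have "\<dots> \<le> K powr p"
    using le assms by (intro powr_mono2) auto
  finally show ?thesis
    using fin by (metis ennreal_enn2real ennreal_leI infinity_ennreal_def less_top)
qed

lemma Lp_norm_leI:
  assumes "0 < p" "0 \<le> K" "(\<integral>\<^sup>+ x. ennreal (norm (f x) powr p) \<partial>M) \<le> ennreal (K powr p)"
  shows "Lp_norm (ennreal p) M f \<le> ennreal K"
proof -
  let ?I = "\<integral>\<^sup>+ x. ennreal (norm (f x) powr p) \<partial>M"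
  have fin: "?I \<noteq> \<infinity>" using assms(3) by (auto simp: top_unique)
  have "enn2real ?I \<le> K powr p" using assms(3) by (intro enn2real_leI) auto
  then have "enn2real ?I powr (1 / p) \<le> (K powr p) powr (1 / p)"
    using assms by (intro powr_mono2) auto
  also have "\<dots> = K" using assms by (simp add: powr_powr)
  finally show ?thesis
    using fin assms by (auto simp: Lp_norm_def Let_def intro: ennreal_leI)
qed

text \<open>Both reciprocals are at most 1, hence finite, so their sum can be taken in the reals.
  The block normalisation thus becomes |M| to the power 1/q - 1, also for infinite \<open>q\<close>,
  where 1/q is 0.\<close>

lemma enn2real_inverse_conjugate_exponent:
  assumes "1 < q"
  shows "enn2real (inverse (conjugate_exponent q)) = 1 - enn2real (inverse q)"
proof -
  have "inverse q \<le> 1" "inverse (conjugate_exponent q) \<le> 1"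
    using conjugate_exponent[OF assms] by (metis le_iff_add add.commute)+
  then have "inverse q < top" "inverse (conjugate_exponent q) < top"
    using ennreal_one_less_top le_less_trans by blast+
  then have "enn2real (inverse q) + enn2real (inverse (conjugate_exponent q)) = enn2real 1"
    using conjugate_exponent[OF assms] by (metis enn2real_plus)
  then show ?thesis by simp
qed

text \<open>Replaces Hoelder's inequality, at the price of the factor 2:
  \<open>u\<^sup>r \<le> \<theta>\<^bsup>r-q\<^esup> u\<^sup>q + \<theta>\<^sup>r\<close>, with the optimal threshold \<open>\<theta> = \<kappa>\<^bsup>-1/q\<^esup> / |M|\<close>.\<close>

lemma is_block_integral_le:
  fixes a :: "real ^ 'n::finite \<Rightarrow> complex"
  assumes block: "is_block q M a" and M: "M \<in> sets sphere_measure" "0 < measure sphere_measure M"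
    and q: "1 < q" and r: "0 < r" "ennreal r < q" and \<kappa>: "0 < \<kappa>"
    and F: "F \<in> sets sphere_measure"
      "measure sphere_measure (F \<inter> M) \<le> \<kappa> * measure sphere_measure M"
  shows "(\<integral>\<^sup>+ x\<in>F. ennreal (norm (a x) powr r) \<partial>sphere_measure)
    \<le> ennreal (2 * measure sphere_measure M powr (1 - r) * \<kappa> powr (1 - r * enn2real (inverse q)))"
proof -
  define m where "m = measure sphere_measure M"
  have m: "0 < m" using M by (simp add: m_def)
  have [measurable]: "a \<in> borel_measurable sphere_measure" "F \<in> sets sphere_measure" "M \<in> sets sphere_measure"
    and supp: "AE x in sphere_measure. x \<notin> M \<longrightarrow> a x = 0"
    and norm: "Lp_norm q sphere_measure a \<le> ennreal (m powr (enn2real (inverse q) - 1))"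
    using block F M by (auto simp: is_block_def m_def enn2real_inverse_conjugate_exponent[OF q])
  have FM: "emeasure sphere_measure (F \<inter> M) \<le> ennreal (\<kappa> * m)"
    using F by (simp add: sphere.emeasure_eq_measure m_def ennreal_leI)
  show ?thesis
  proof (cases q)
    case (real Q)
    with q have Q: "1 < Q" by (metis ennreal_1 ennreal_less_iff zero_le_one)
    have rQ: "r < Q" using r real by (simp add: ennreal_less_iff)
    have invq: "enn2real (inverse q) = 1 / Q"
      using real Q by (simp add: inverse_ennreal divide_inverse)
    have "(\<integral>\<^sup>+ x. ennreal (norm (a x) powr Q) \<partial>sphere_measure) \<le> ennreal ((m powr (1 / Q - 1)) powr Q)"
      using norm Q unfolding invq unfolding real by (intro Lp_norm_leD) auto
    also have "(m powr (1 / Q - 1)) powr Q = m powr (1 - Q)"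
      using Q by (simp add: powr_powr left_diff_distrib)
    finally have I: "(\<integral>\<^sup>+ x. ennreal (norm (a x) powr Q) \<partial>sphere_measure) \<le> ennreal (m powr (1 - Q))" .
    define \<theta> where "\<theta> = \<kappa> powr (- 1 / Q) / m"
    have \<theta>: "0 < \<theta>" using m \<kappa> by (simp add: \<theta>_def)
    have ptw: "u powr r \<le> \<theta> powr (r - Q) * u powr Q + \<theta> powr r" if "0 \<le> u" for u
    proof (cases "u \<le> \<theta>")
      case True
      then have "u powr r \<le> \<theta> powr r" using that r by (intro powr_mono2) auto
      then show ?thesis by (smt (verit) powr_ge_zero mult_nonneg_nonneg)
    next
      case False
      then have "u powr r = u powr (r - Q) * u powr Q" using \<theta> by (simp flip: powr_add)
      also have "\<dots> \<le> \<theta> powr (r - Q) * u powr Q"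
        using False \<theta> rQ by (intro mult_right_mono powr_mono2') auto
      finally show ?thesis by (smt (verit) powr_ge_zero)
    qed
    have "(\<integral>\<^sup>+ x\<in>F. ennreal (norm (a x) powr r) \<partial>sphere_measure)
      \<le> (\<integral>\<^sup>+ x. ennreal (\<theta> powr (r - Q)) * ennreal (norm (a x) powr Q)
            + ennreal (\<theta> powr r) * indicator (F \<inter> M) x \<partial>sphere_measure)"
    proof (rule nn_integral_mono_AE)
      show "AE x in sphere_measure. ennreal (norm (a x) powr r) * indicator F x
        \<le> ennreal (\<theta> powr (r - Q)) * ennreal (norm (a x) powr Q) + ennreal (\<theta> powr r) * indicator (F \<inter> M) x"
        \<comment> \<open>Off \<open>M\<close> the left side vanishes almost everywhere because
          \<open>0 powr r = 0\<close>, so the constant term is needed only on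
          \<open>F \<inter> M\<close>.\<close>
        using supp
      proof eventually_elim
        case (elim x)
        then show ?case
          using ennreal_leI[OF ptw[of "norm (a x)"]]
          by (auto split: split_indicator simp: ennreal_mult)
      qed
    qed
    also have "\<dots> = ennreal (\<theta> powr (r - Q)) * (\<integral>\<^sup>+ x. ennreal (norm (a x) powr Q) \<partial>sphere_measure)
        + ennreal (\<theta> powr r) * emeasure sphere_measure (F \<inter> M)"
      by (subst nn_integral_add) (auto simp: nn_integral_cmult nn_integral_cmult_indicator)
    also have "\<dots> \<le> ennreal (\<theta> powr (r - Q)) * ennreal (m powr (1 - Q)) + ennreal (\<theta> powr r) * ennreal (\<kappa> * m)"
      using I FM by (intro add_mono mult_left_mono) auto
    also have "\<dots> = ennreal (\<theta> powr (r - Q) * m powr (1 - Q) + \<theta> powr r * (\<kappa> * m))"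
      using m \<kappa> by (simp add: ennreal_mult)
    \<comment> \<open>The choice of \<open>\<theta>\<close> makes both summands equal, whence the
      factor 2.\<close>
    also have "\<theta> powr (r - Q) * m powr (1 - Q) = m powr (1 - r) * \<kappa> powr (1 - r / Q)"
    proof -
      have "\<theta> powr (r - Q) = \<kappa> powr (- 1 / Q * (r - Q)) * m powr (Q - r)"
        using m \<kappa> by (simp add: \<theta>_def powr_divide powr_powr powr_minus_divide[of m "Q - r", simplified])
      moreover have "- 1 / Q * (r - Q) = 1 - r / Q" using Q by (simp add: field_simps)
      moreover have "m powr (Q - r) * m powr (1 - Q) = m powr (1 - r)" by (simp flip: powr_add)
      ultimately show ?thesis by (simp add: mult_ac)
    qed
    also have "\<theta> powr r * (\<kappa> * m) = m powr (1 - r) * \<kappa> powr (1 - r / Q)"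
    proof -
      have "\<theta> powr r = \<kappa> powr (- r / Q) * m powr (- r)"
        using m \<kappa> by (simp add: \<theta>_def powr_divide powr_powr powr_mult powr_minus_divide)
      moreover have "\<kappa> powr (- r / Q) * \<kappa> = \<kappa> powr (1 - r / Q)"
        using powr_add[of \<kappa> "- r / Q" 1] \<kappa> by simp
      moreover have "m powr (- r) * m = m powr (1 - r)"
        using powr_add[of m "- r" 1] m by simp
      ultimately show ?thesis by (metis mult.commute mult.left_commute)
    qed
    finally show ?thesis by (simp add: invq m_def mult_ac)
  next
    \<comment> \<open>Here 1/q is 0 and the normalisation bounds the block by \<open>1 / m\<close>
      almost everywhere; integrating this bound over \<open>F \<inter> M\<close> replaces the
      splitting at a threshold.\<close>
    case top
    have "esssup sphere_measure (\<lambda>x. ennreal (norm (a x))) \<le> ennreal (1 / m)"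
      using norm m by (simp add: top Lp_norm_def powr_minus_divide)
    moreover have "AE x in sphere_measure. ennreal (norm (a x)) \<le> esssup sphere_measure (\<lambda>x. ennreal (norm (a x)))"
      by (rule esssup_AE)
    ultimately have bd: "AE x in sphere_measure. norm (a x) \<le> 1 / m"
      using m by (auto elim!: eventually_mono dest: order_trans simp: ennreal_le_iff)
    have "(\<integral>\<^sup>+ x\<in>F. ennreal (norm (a x) powr r) \<partial>sphere_measure)
      \<le> (\<integral>\<^sup>+ x. ennreal ((1 / m) powr r) * indicator (F \<inter> M) x \<partial>sphere_measure)"
    proof (rule nn_integral_mono_AE)
      show "AE x in sphere_measure. ennreal (norm (a x) powr r) * indicator F x
        \<le> ennreal ((1 / m) powr r) * indicator (F \<inter> M) x"
        using supp bd
      proof eventually_elim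
        case (elim x)
        then show ?case
          using powr_mono2[of r "norm (a x)" "1 / m"] r
          by (auto split: split_indicator intro: ennreal_leI)
      qed
    qed
    also have "\<dots> = ennreal ((1 / m) powr r) * emeasure sphere_measure (F \<inter> M)"
      by (simp add: nn_integral_cmult_indicator)
    also have "\<dots> \<le> ennreal ((1 / m) powr r) * ennreal (\<kappa> * m)"
      using FM by (intro mult_left_mono) auto
    also have "\<dots> = ennreal ((1 / m) powr r * (\<kappa> * m))"
      using m \<kappa> by (simp add: ennreal_mult)
    also have "(1 / m) powr r * (\<kappa> * m) = m powr (1 - r) * \<kappa>"
      using m by (simp add: powr_divide powr_diff field_simps)
    also have "ennreal \<dots> \<le> ennreal (2 * m powr (1 - r) * \<kappa> powr (1 - r * enn2real (inverse q)))"
      using m \<kappa> by (intro ennreal_leI) (simp add: top)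
    finally show ?thesis by (simp add: m_def)
  qed
qed

text \<open>\<open>is_block_integral_le\<close> with the whole sphere as \<open>F\<close> and
  \<open>\<kappa> = 1\<close> bounds the integral of the P-th power up to a factor 2. Halving gains
  \<open>(1/2) powr P\<close>, at most 1/2, which absorbs it.\<close>

lemma is_block_half:
  fixes a :: "real ^ 'n::finite \<Rightarrow> complex"
  assumes block: "is_block q M a" and M: "is_cap M" and pq: "1 < p" "p < q"
  shows "is_block p M (\<lambda>x. a x / 2)"
proof -
  define m where "m = measure sphere_measure M"
  have m: "0 < m" using measure_cap_pos[OF M] by (simp add: m_def)
  obtain P where P: "p = ennreal P" "1 < P"
    using ex_real_exponent[OF pq] .
  have invp: "enn2real (inverse p) = 1 / P"
    using P by (simp add: inverse_ennreal divide_inverse)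
  have q: "1 < q" using pq by simp
  have [measurable]: "a \<in> borel_measurable sphere_measure" using block by (simp add: is_block_def)
  have "(\<integral>\<^sup>+ x. ennreal (norm (a x / 2) powr P) \<partial>sphere_measure)
      = (\<integral>\<^sup>+ x. ennreal ((1/2) powr P) * (ennreal (norm (a x) powr P) * indicator (space sphere_measure) x) \<partial>sphere_measure)"
    by (intro nn_integral_cong) (simp add: norm_divide powr_divide flip: ennreal_mult)
  also have "\<dots> = ennreal ((1/2) powr P) * (\<integral>\<^sup>+ x\<in>space sphere_measure. ennreal (norm (a x) powr P) \<partial>sphere_measure)"
    by (intro nn_integral_cmult) auto
  also have "\<dots> \<le> ennreal ((1/2) powr P) * ennreal (2 * m powr (1 - P) * 1 powr (1 - P * enn2real (inverse q)))"
    unfolding m_def using P pq m block q sets_is_cap[OF M]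
    by (intro mult_left_mono is_block_integral_le)
      (auto simp: m_def intro!: sphere.finite_measure_mono)
  also have "\<dots> = ennreal ((1/2) powr P * 2 * m powr (1 - P))"
    by (simp add: ennreal_mult mult.assoc)
  also have "\<dots> \<le> ennreal (m powr (1 - P))"
  proof -
    have "(1/2::real) powr P \<le> (1/2) powr 1" using P by (intro powr_mono') auto
    then have "(1/2) powr P * 2 * m powr (1 - P) \<le> 1 * m powr (1 - P)"
      by (intro mult_right_mono) auto
    then show ?thesis by (intro ennreal_leI) simp
  qed
  also have "m powr (1 - P) = (m powr (1 / P - 1)) powr P"
    using P by (simp add: powr_powr left_diff_distrib)
  finally have "Lp_norm p sphere_measure (\<lambda>x. a x / 2) \<le> ennreal (m powr (1 / P - 1))"
    unfolding P(1) using P by (intro Lp_norm_leI) auto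
  then show ?thesis
    using block unfolding is_block_def enn2real_inverse_conjugate_exponent[OF pq(1)] invp m_def
    by (auto elim: eventually_mono)
qed

text \<open>Doubled coefficients compensate for halved blocks: the partial sums stay the same and
  the weighted series only doubles.\<close>

lemma block_space_mono:
  assumes pq: "1 < p" "p < q"
  shows "block_space q \<nu> \<subseteq> (block_space p \<nu> :: (real ^ 'n::finite \<Rightarrow> complex) set)"
proof
  fix \<Omega> :: "real ^ 'n \<Rightarrow> complex" assume "\<Omega> \<in> block_space q \<nu>"
  then obtain \<mu> a M where int: "integrable sphere_measure \<Omega>"
    and blocks: "\<And>j::nat. is_cap (M j) \<and> is_block q (M j) (a j)"
    and sum: "summable (\<lambda>j. norm (\<mu> j) * (1 + log_plus (1 / measure sphere_measure (M j)) powr (1 + \<nu>)))"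
    and lim: "(\<lambda>N. \<integral>\<^sup>+ x. ennreal (norm (\<Omega> x - (\<Sum>j<N. \<mu> j * a j x))) \<partial>sphere_measure) \<longlonglongrightarrow> 0"
    by (auto simp: block_space_def)
  have "summable (\<lambda>j. norm (2 * \<mu> j) * (1 + log_plus (1 / measure sphere_measure (M j)) powr (1 + \<nu>)))"
    using summable_mult[OF sum, of 2] by (simp add: norm_mult mult.assoc)
  moreover have "\<And>j. is_cap (M j) \<and> is_block p (M j) (\<lambda>x. a j x / 2)"
    using blocks is_block_half[OF _ _ pq] by blast
  ultimately show "\<Omega> \<in> block_space p \<nu>"
    unfolding block_space_def using int lim
    by (intro CollectI conjI exI[of _ "\<lambda>j. 2 * \<mu> j"] exI[of _ "\<lambda>j x. a j x / 2"] exI[of _ M]) auto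
qed

subsection \<open>Strictness\<close>

text \<open>\<open>S\<close> is the weighted coefficient sum of one decomposition of
  \<open>\<Omega>\<close>. It is fixed before \<open>F\<close> and \<open>K\<close>, so a single
  \<open>S\<close> serves a whole sequence of test sets.\<close>

lemma block_space_integral_le:
  fixes \<Omega> :: "real ^ 'n::finite \<Rightarrow> complex"
  assumes "\<Omega> \<in> block_space q \<nu>"
  obtains S :: real where "0 \<le> S"
    "\<And>F K. F \<in> sets sphere_measure \<Longrightarrow> 0 \<le> K \<Longrightarrow>
      (\<And>M a. is_cap M \<Longrightarrow> is_block q M a \<Longrightarrow> (\<integral>\<^sup>+ x\<in>F. ennreal (norm (a x)) \<partial>sphere_measure)
         \<le> ennreal (K * (1 + log_plus (1 / measure sphere_measure M) powr (1 + \<nu>)))) \<Longrightarrow>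
      (\<integral>\<^sup>+ x\<in>F. ennreal (norm (\<Omega> x)) \<partial>sphere_measure) \<le> ennreal (K * S)"
proof -
  define w where "w M = 1 + log_plus (1 / measure sphere_measure M) powr (1 + \<nu>)" for M :: "(real ^ 'n) set"
  have w: "0 \<le> w M" for M by (simp add: w_def add_nonneg_nonneg)
  obtain \<mu> a M where int: "integrable sphere_measure \<Omega>"
    and blocks: "\<And>j::nat. is_cap (M j)" "\<And>j. is_block q (M j) (a j)"
    and sum: "summable (\<lambda>j. norm (\<mu> j) * w (M j))"
    and lim: "(\<lambda>N. \<integral>\<^sup>+ x. ennreal (norm (\<Omega> x - (\<Sum>j<N. \<mu> j * a j x))) \<partial>sphere_measure) \<longlonglongrightarrow> 0"
    using assms by (auto simp: block_space_def w_def)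
  have [measurable]: "\<Omega> \<in> borel_measurable sphere_measure" "a j \<in> borel_measurable sphere_measure" for j
    using int blocks(2)[of j] by (auto simp: is_block_def)
  define S where "S = (\<Sum>j. norm (\<mu> j) * w (M j))"
  show ?thesis
  proof (rule that[of S])
    show "0 \<le> S" unfolding S_def using w by (intro suminf_nonneg sum) simp
    fix F K assume F [measurable]: "F \<in> sets (sphere_measure :: (real ^ 'n) measure)" and K: "0 \<le> (K::real)"
      and bd: "\<And>M a. is_cap M \<Longrightarrow> is_block q M a \<Longrightarrow> (\<integral>\<^sup>+ x\<in>F. ennreal (norm (a x)) \<partial>sphere_measure)
         \<le> ennreal (K * (1 + log_plus (1 / measure sphere_measure M) powr (1 + \<nu>)))"
    let ?e = "\<lambda>N. \<integral>\<^sup>+ x. ennreal (norm (\<Omega> x - (\<Sum>j<N. \<mu> j * a j x))) \<partial>sphere_measure"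
    \<comment> \<open>The remainder is integrated over the whole sphere, so its contribution
      \<open>?e N\<close> tends to 0 independently of \<open>F\<close>.\<close>
    have "(\<integral>\<^sup>+ x\<in>F. ennreal (norm (\<Omega> x)) \<partial>sphere_measure) \<le> ?e N + ennreal (K * S)" for N
    proof -
      have "(\<integral>\<^sup>+ x\<in>F. ennreal (norm (\<Omega> x)) \<partial>sphere_measure)
        \<le> (\<integral>\<^sup>+ x. ennreal (norm (\<Omega> x - (\<Sum>j<N. \<mu> j * a j x)))
            + (\<Sum>j<N. ennreal (norm (\<mu> j)) * (ennreal (norm (a j x)) * indicator F x)) \<partial>sphere_measure)"
      proof (rule nn_integral_mono)
        fix x
        have "norm (\<Omega> x) \<le> norm (\<Omega> x - (\<Sum>j<N. \<mu> j * a j x)) + norm (\<Sum>j<N. \<mu> j * a j x)"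
          by norm
        also have "norm (\<Sum>j<N. \<mu> j * a j x) \<le> (\<Sum>j<N. norm (\<mu> j) * norm (a j x))"
          by (rule order_trans[OF norm_sum]) (simp add: norm_mult)
        finally have "ennreal (norm (\<Omega> x)) \<le> ennreal (norm (\<Omega> x - (\<Sum>j<N. \<mu> j * a j x)))
            + ennreal (\<Sum>j<N. norm (\<mu> j) * norm (a j x))"
          by (subst ennreal_plus[symmetric]) (auto intro: ennreal_leI sum_nonneg)
        also have "ennreal (\<Sum>j<N. norm (\<mu> j) * norm (a j x)) = (\<Sum>j<N. ennreal (norm (\<mu> j)) * ennreal (norm (a j x)))"
          by (subst sum_ennreal[symmetric]) (auto simp: ennreal_mult)
        finally show "ennreal (norm (\<Omega> x)) * indicator F x \<le> ennreal (norm (\<Omega> x - (\<Sum>j<N. \<mu> j * a j x)))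
            + (\<Sum>j<N. ennreal (norm (\<mu> j)) * (ennreal (norm (a j x)) * indicator F x))"
          by (auto split: split_indicator)
      qed
      also have "\<dots> = ?e N + (\<Sum>j<N. ennreal (norm (\<mu> j)) * (\<integral>\<^sup>+ x\<in>F. ennreal (norm (a j x)) \<partial>sphere_measure))"
        by (subst nn_integral_add, simp, simp) (simp add: nn_integral_sum nn_integral_cmult)
      also have "(\<Sum>j<N. ennreal (norm (\<mu> j)) * (\<integral>\<^sup>+ x\<in>F. ennreal (norm (a j x)) \<partial>sphere_measure))
          \<le> (\<Sum>j<N. ennreal (norm (\<mu> j)) * ennreal (K * w (M j)))"
        using bd[OF blocks] by (intro sum_mono mult_left_mono) (auto simp: w_def)
      also have "\<dots> = ennreal (\<Sum>j<N. K * (norm (\<mu> j) * w (M j)))"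
        using w K by (subst sum_ennreal[symmetric]) (auto simp: mult_ac simp flip: ennreal_mult)
      also have "\<dots> \<le> ennreal (K * S)"
        unfolding S_def using w K sum
        by (intro ennreal_leI) (auto simp flip: sum_distrib_left intro!: mult_left_mono sum_le_suminf)
      finally show ?thesis by (simp add: add_left_mono)
    qed
    moreover have "(\<lambda>N. ?e N + ennreal (K * S)) \<longlonglongrightarrow> 0 + ennreal (K * S)"
      by (intro tendsto_add lim tendsto_const)
    ultimately show "(\<integral>\<^sup>+ x\<in>F. ennreal (norm (\<Omega> x)) \<partial>sphere_measure) \<le> ennreal (K * S)"
      by (intro LIMSEQ_le_const[where a = "\<integral>\<^sup>+ x\<in>F. ennreal (norm (\<Omega> x)) \<partial>sphere_measure"]) auto
  qed
qed

text \<open>On a common cap the logarithmic weight is a constant factor, so geometric coefficients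
  are summable against it. Nonnegativity excludes cancellation, so the sum dominates each of its
  terms.\<close>

lemma block_space_superposition:
  fixes b :: "nat \<Rightarrow> real ^ 'n::finite \<Rightarrow> real"
  assumes p: "1 < p" and M: "is_cap M"
    and block: "\<And>i. is_block p M (\<lambda>x. complex_of_real (b i x))" and nonneg: "\<And>i x. 0 \<le> b i x"
  obtains f where "f \<in> block_space p \<nu>"
    "AE x in sphere_measure. \<forall>i. (1/2) ^ i * b i x \<le> norm (f x)"
proof -
  let ?s = "sphere_measure :: (real ^ 'n) measure"
  have meas [measurable]: "b i \<in> borel_measurable ?s" for i
  proof -
    have "(\<lambda>x. complex_of_real (b i x)) \<in> borel_measurable ?s" using block by (simp add: is_block_def)
    then have "(\<lambda>x. Re (complex_of_real (b i x))) \<in> borel_measurable ?s" by measurable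
    then show ?thesis by simp
  qed
  \<comment> \<open>The block estimate with \<open>r = 1\<close> and \<open>\<kappa> = 1\<close>,
    where the power of the measure of \<open>M\<close> has exponent 0.\<close>
  have int_b: "(\<integral>\<^sup>+ x. ennreal (b i x) \<partial>?s) \<le> 2" for i
  proof -
    have "(\<integral>\<^sup>+ x. ennreal (b i x) \<partial>?s) = (\<integral>\<^sup>+ x\<in>space ?s. ennreal (norm (complex_of_real (b i x)) powr 1) \<partial>?s)"
      using nonneg by (intro nn_integral_cong) simp
    also have "\<dots> \<le> ennreal (2 * measure ?s M powr (1 - 1) * 1 powr (1 - 1 * enn2real (inverse p)))"
      using p measure_cap_pos[OF M] sets_is_cap[OF M] block
      by (intro is_block_integral_le) (auto intro!: sphere.finite_measure_mono)
    finally show ?thesis using measure_cap_pos[OF M] by simp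
  qed
  define t where "t i x = (1/2) ^ i * b i x" for i x
  have t: "0 \<le> t i x" for i x using nonneg by (simp add: t_def)
  have [measurable]: "t i \<in> borel_measurable ?s" for i unfolding t_def by measurable
  have tail: "(\<integral>\<^sup>+ x. (\<Sum>j. ennreal (t (j + N) x)) \<partial>?s) \<le> ennreal (4 * (1/2) ^ N)" for N
  proof -
    have "(\<integral>\<^sup>+ x. (\<Sum>j. ennreal (t (j + N) x)) \<partial>?s) = (\<Sum>j. \<integral>\<^sup>+ x. ennreal (t (j + N) x) \<partial>?s)"
      by (intro nn_integral_suminf) measurable
    also have "\<dots> \<le> (\<Sum>j. ennreal (2 * (1/2) ^ N * (1/2) ^ j))"
    proof (intro suminf_le summableI)
      fix j
      have "(\<integral>\<^sup>+ x. ennreal (t (j + N) x) \<partial>?s) = ennreal ((1/2) ^ (j + N)) * (\<integral>\<^sup>+ x. ennreal (b (j + N) x) \<partial>?s)"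
        by (subst nn_integral_cmult[symmetric]) (auto simp: t_def ennreal_mult nonneg)
      also have "\<dots> \<le> ennreal ((1/2) ^ (j + N)) * 2" using int_b by (intro mult_left_mono) auto
      also have "\<dots> = ennreal (2 * (1/2) ^ N * (1/2) ^ j)"
        by (simp add: power_add mult_ac ennreal_mult' flip: ennreal_numeral)
      finally show "(\<integral>\<^sup>+ x. ennreal (t (j + N) x) \<partial>?s) \<le> ennreal (2 * (1/2) ^ N * (1/2) ^ j)" .
    qed
    also have "\<dots> = ennreal (\<Sum>j. 2 * (1/2) ^ N * (1/2) ^ j)"
      by (intro suminf_ennreal2) (auto intro!: summable_mult summable_geometric)
    also have "(\<Sum>j. 2 * (1/2) ^ N * (1/2::real) ^ j) = 4 * (1/2) ^ N"
      by (subst suminf_mult) (auto simp: suminf_geometric summable_geometric)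
    finally show ?thesis .
  qed
  have "(\<integral>\<^sup>+ x. (\<Sum>j. ennreal (t j x)) \<partial>?s) \<noteq> \<infinity>" using tail[of 0] by (auto simp: top_unique)
  then have "AE x in ?s. (\<Sum>j. ennreal (t j x)) \<noteq> \<infinity>"
    by (intro nn_integral_PInf_AE) measurable
  then have summ: "AE x in ?s. summable (\<lambda>j. t j x)"
    by eventually_elim (auto intro: summable_suminf_not_top t)
  \<comment> \<open>Where the series diverges, on a null set, this value is meaningless; the
    comparisons of \<open>f\<close> with the terms and partial sums hold almost everywhere.\<close>
  define f where "f x = complex_of_real (\<Sum>j. t j x)" for x
  have [measurable]: "f \<in> borel_measurable ?s" unfolding f_def by measurable
  have diff: "AE x in ?s. ennreal (norm (f x - (\<Sum>j<N. (1/2) ^ j * complex_of_real (b j x)))) = (\<Sum>j. ennreal (t (j + N) x))" for N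
    using summ
  proof eventually_elim
    case (elim x)
    have "f x - (\<Sum>j<N. (1/2) ^ j * complex_of_real (b j x)) = complex_of_real ((\<Sum>j. t j x) - (\<Sum>j<N. t j x))"
      by (simp add: f_def t_def)
    also have "(\<Sum>j. t j x) - (\<Sum>j<N. t j x) = (\<Sum>j. t (j + N) x)"
      using suminf_minus_initial_segment[OF elim, of N] by simp
    finally have "norm (f x - (\<Sum>j<N. (1/2) ^ j * complex_of_real (b j x))) = (\<Sum>j. t (j + N) x)"
      using summable_ignore_initial_segment[OF elim, of N] t by (simp add: suminf_nonneg)
    then show ?case
      using summable_ignore_initial_segment[OF elim, of N] t by (simp add: suminf_ennreal2)
  qed
  have err: "(\<integral>\<^sup>+ x. ennreal (norm (f x - (\<Sum>j<N. (1/2) ^ j * complex_of_real (b j x)))) \<partial>?s) \<le> ennreal (4 * (1/2) ^ N)" for N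
    using nn_integral_cong_AE[OF diff[of N]] tail[of N] by simp
  show ?thesis
  proof (rule that[of f])
    show "AE x in ?s. \<forall>i. (1/2) ^ i * b i x \<le> norm (f x)"
      using summ
    proof eventually_elim
      case (elim x)
      have "t i x \<le> norm (f x)" for i
        using sum_le_suminf[OF elim, of "{i}"] t suminf_nonneg[OF elim] by (simp add: f_def)
      then show ?case by (simp add: t_def)
    qed
    have "(\<integral>\<^sup>+ x. ennreal (norm (f x)) \<partial>?s) < \<infinity>"
      using err[of 0] by (auto intro: le_less_trans)
    then have "integrable ?s f" by (intro integrableI_bounded) auto
    moreover have "(\<lambda>N. \<integral>\<^sup>+ x. ennreal (norm (f x - (\<Sum>j<N. (1/2) ^ j * complex_of_real (b j x)))) \<partial>?s) \<longlonglongrightarrow> 0"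
    proof (rule tendsto_sandwich[OF _ _ tendsto_const])
      have "(\<lambda>N. 4 * (1/2::real) ^ N) \<longlonglongrightarrow> 4 * 0"
        by (intro tendsto_intros LIMSEQ_power_zero) auto
      then show "(\<lambda>N. ennreal (4 * (1/2) ^ N)) \<longlonglongrightarrow> 0"
        using tendsto_ennrealI by fastforce
    qed (use err in auto)
    moreover have "summable (\<lambda>j. norm ((1/2::complex) ^ j) * (1 + log_plus (1 / measure ?s M) powr (1 + \<nu>)))"
      by (intro summable_mult2) (simp add: norm_power summable_geometric)
    ultimately show "f \<in> block_space p \<nu>"
      unfolding block_space_def using M block
      by (intro CollectI conjI exI[of _ "\<lambda>j. (1/2) ^ j"] exI[of _ "\<lambda>j x. complex_of_real (b j x)"] exI[of _ "\<lambda>_. M"]) auto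
  qed
qed

text \<open>The exponent of \<open>\<epsilon>\<close> is 1/q'. Caps below a threshold are controlled
  by their weight, all others by the density of \<open>E\<close>. The threshold depends on
  \<open>\<epsilon>\<close>, but \<open>c\<close> and \<open>K\<close> do not.\<close>

lemma ex_block_test_set:
  assumes n: "2 \<le> CARD('n::finite)" and \<nu>: "-1 < \<nu>" and q: "1 < q"
  obtains \<epsilon>0 c K :: real where "0 < \<epsilon>0" "0 < c" "0 < K"
    "\<And>\<epsilon>. 0 < \<epsilon> \<Longrightarrow> \<epsilon> \<le> \<epsilon>0 \<Longrightarrow> \<exists>E :: (real ^ 'n) set. E \<in> sets sphere_measure \<and>
       c * \<epsilon> \<le> measure sphere_measure E \<and> measure sphere_measure E \<le> K * \<epsilon> \<and>
       (\<forall>M a. is_cap M \<longrightarrow> is_block q M a \<longrightarrow> (\<integral>\<^sup>+ x\<in>E. ennreal (norm (a x)) \<partial>sphere_measure)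
         \<le> ennreal (K * \<epsilon> powr (1 - enn2real (inverse q)) *
              (1 + log_plus (1 / measure sphere_measure M) powr (1 + \<nu>))))"
proof -
  let ?n = "CARD('n) - 1"
  let ?\<sigma> = "measure (sphere_measure :: (real ^ 'n) measure)"
  define \<beta> where "\<beta> = 1 - enn2real (inverse q)"
  have \<beta>: "0 < \<beta>"
  proof (cases q)
    case (real Q)
    with q have "1 < Q" by (metis ennreal_1 ennreal_less_iff zero_le_one)
    then show ?thesis using real by (simp add: \<beta>_def inverse_ennreal field_simps)
  qed (simp add: \<beta>_def)
  obtain c C :: real where c: "0 < c" and C: "0 < C"
    and ex: "\<And>t \<delta>. 0 < t \<Longrightarrow> t \<le> 1/2 \<Longrightarrow> 0 < \<delta> \<Longrightarrow>
      \<exists>E :: (real ^ 'n) set. E \<in> sets sphere_measure \<and> E \<subseteq> sphere 0 1 \<and>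
         c * t ^ ?n \<le> ?\<sigma> E \<and>
         (\<forall>M. is_cap M \<longrightarrow> ?\<sigma> M < \<delta> \<or> ?\<sigma> (E \<inter> M) \<le> C * t ^ ?n * ?\<sigma> M)"
    using ex_evenly_spread_set[OF n] by blast
  \<comment> \<open>The first entry serves the upper bound for the measure of \<open>E\<close>, the
    second the bound for integrals of blocks.\<close>
  define K where "K = max (C * ?\<sigma> (sphere 0 1)) (2 * C powr \<beta>)"
  show ?thesis
  proof (rule that[of "(1/2) ^ ?n" c K])
    show "0 < (1/2::real) ^ ?n" "0 < c" "0 < K" using c C by (auto simp: K_def less_max_iff_disj)
    fix \<epsilon> :: real assume \<epsilon>: "0 < \<epsilon>" "\<epsilon> \<le> (1/2) ^ ?n"
    have n0: "0 < ?n" using n by simp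
    \<comment> \<open>Turns the density \<open>t ^ (n - 1)\<close> into \<open>\<epsilon>\<close>;
      the upper limit on \<open>\<epsilon>\<close> is exactly \<open>t \<le> 1/2\<close>.\<close>
    define t where "t = root ?n \<epsilon>"
    have t: "0 < t" "t ^ ?n = \<epsilon>" using \<epsilon> n0 by (auto simp: t_def)
    have "t \<le> 1/2"
      by (rule iffD1[OF power_mono_iff[of t "1/2" ?n]]) (use t \<epsilon> n0 in auto)
    define \<kappa> where "\<kappa> = C * \<epsilon>"
    have \<kappa>: "0 < \<kappa>" using C \<epsilon> by (simp add: \<kappa>_def)
    \<comment> \<open>The first entry keeps the whole sphere among the caps with controlled density,
      which bounds the measure of \<open>E\<close>. The second makes the weight of every smaller cap
      exceed \<open>\<kappa> powr (- \<beta>)\<close>.\<close>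
    define \<delta> where "\<delta> = min (?\<sigma> (sphere 0 1)) (exp (- (\<kappa> powr (- \<beta> / (1 + \<nu>)))))"
    have \<delta>: "0 < \<delta>" using measure_cap_pos[OF is_cap_sphere] by (simp add: \<delta>_def)
    obtain E :: "(real ^ 'n) set" where E: "E \<in> sets sphere_measure" "E \<subseteq> sphere 0 1" "c * \<epsilon> \<le> ?\<sigma> E"
      and spread: "\<And>M. is_cap M \<Longrightarrow> ?\<sigma> M < \<delta> \<or> ?\<sigma> (E \<inter> M) \<le> \<kappa> * ?\<sigma> M"
      using ex[OF t(1) \<open>t \<le> 1/2\<close> \<delta>] unfolding t(2) \<kappa>_def by blast
    have "?\<sigma> E \<le> \<kappa> * ?\<sigma> (sphere 0 1)"
      using spread[OF is_cap_sphere] E(2) by (simp add: \<delta>_def Int_absorb2)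
    also have "\<dots> \<le> K * \<epsilon>" using \<epsilon> by (simp add: \<kappa>_def K_def mult.commute mult.left_commute mult_left_mono)
    finally have upper: "?\<sigma> E \<le> K * \<epsilon>" .
    have "(\<integral>\<^sup>+ x\<in>E. ennreal (norm (a x)) \<partial>sphere_measure)
         \<le> ennreal (K * \<epsilon> powr \<beta> * (1 + log_plus (1 / ?\<sigma> M) powr (1 + \<nu>)))"
      if M: "is_cap M" and a: "is_block q M a" for M a
    proof -
      have pos: "0 < ?\<sigma> M" using measure_cap_pos[OF M] .
      have bound: "(\<integral>\<^sup>+ x\<in>E. ennreal (norm (a x)) \<partial>sphere_measure) \<le> ennreal (2 * k powr \<beta>)"
        if "0 < k" "?\<sigma> (E \<inter> M) \<le> k * ?\<sigma> M" for k
        using is_block_integral_le[OF a sets_is_cap[OF M] pos q, of 1 k E] E(1) that pos q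
        by (simp add: \<beta>_def)
      have w: "0 \<le> log_plus (1 / ?\<sigma> M) powr (1 + \<nu>)" by simp
      have K: "2 * \<kappa> powr \<beta> \<le> K * \<epsilon> powr \<beta>"
        using \<epsilon> C by (auto simp: \<kappa>_def K_def powr_mult intro!: mult_right_mono)
      have "(\<integral>\<^sup>+ x\<in>E. ennreal (norm (a x)) \<partial>sphere_measure)
        \<le> ennreal (2 * \<kappa> powr \<beta> * (1 + log_plus (1 / ?\<sigma> M) powr (1 + \<nu>)))"
      proof (cases "?\<sigma> M < \<delta>")
        \<comment> \<open>The trivial density 1 bounds the integral by 2, and the weight is large
          enough to outweigh the factor \<open>\<kappa> powr \<beta>\<close>.\<close>
        case True
        have "ln (?\<sigma> M) \<le> - (\<kappa> powr (- \<beta> / (1 + \<nu>)))"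
          using True pos ln_less_cancel_iff[of "?\<sigma> M" "exp (- (\<kappa> powr (- \<beta> / (1 + \<nu>))))"]
          by (simp add: \<delta>_def)
        then have "\<kappa> powr (- \<beta> / (1 + \<nu>)) \<le> log_plus (1 / ?\<sigma> M)"
          using pos by (simp add: log_plus_def ln_div)
        then have "(\<kappa> powr (- \<beta> / (1 + \<nu>))) powr (1 + \<nu>) \<le> log_plus (1 / ?\<sigma> M) powr (1 + \<nu>)"
          using \<nu> by (intro powr_mono2) auto
        then have "\<kappa> powr (- \<beta>) \<le> log_plus (1 / ?\<sigma> M) powr (1 + \<nu>)"
          using \<nu> by (simp add: powr_powr)
        then have "\<kappa> powr \<beta> * \<kappa> powr (- \<beta>) \<le> \<kappa> powr \<beta> * (1 + log_plus (1 / ?\<sigma> M) powr (1 + \<nu>))"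
          by (intro mult_left_mono) auto
        moreover have "\<kappa> powr \<beta> * \<kappa> powr (- \<beta>) = 1" using \<kappa> by (simp flip: powr_add)
        moreover have "(\<integral>\<^sup>+ x\<in>E. ennreal (norm (a x)) \<partial>sphere_measure) \<le> ennreal 2"
          using bound[of 1] sets_is_cap[OF M] by (auto intro: sphere.finite_measure_mono)
        ultimately show ?thesis
          by (elim order_trans) (intro ennreal_leI, simp)
      next
        case False
        have "2 * \<kappa> powr \<beta> * 1 \<le> 2 * \<kappa> powr \<beta> * (1 + log_plus (1 / ?\<sigma> M) powr (1 + \<nu>))"
          by (intro mult_left_mono) auto
        moreover have "(\<integral>\<^sup>+ x\<in>E. ennreal (norm (a x)) \<partial>sphere_measure) \<le> ennreal (2 * \<kappa> powr \<beta>)"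
          using bound[OF \<kappa>] spread[OF M] False by blast
        ultimately show ?thesis
          by (elim order_trans) (intro ennreal_leI, simp)
      qed
      also have "\<dots> \<le> ennreal (K * \<epsilon> powr \<beta> * (1 + log_plus (1 / ?\<sigma> M) powr (1 + \<nu>)))"
        using K w by (intro ennreal_leI mult_right_mono) auto
      finally show ?thesis .
    qed
    then show "\<exists>E :: (real ^ 'n) set. E \<in> sets sphere_measure \<and>
       c * \<epsilon> \<le> ?\<sigma> E \<and> ?\<sigma> E \<le> K * \<epsilon> \<and>
       (\<forall>M a. is_cap M \<longrightarrow> is_block q M a \<longrightarrow> (\<integral>\<^sup>+ x\<in>E. ennreal (norm (a x)) \<partial>sphere_measure)
         \<le> ennreal (K * \<epsilon> powr (1 - enn2real (inverse q)) *
              (1 + log_plus (1 / ?\<sigma> M) powr (1 + \<nu>))))"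
      using E upper unfolding \<beta>_def by blast
  qed
qed

theorem theoremD:
  fixes p q :: ennreal and \<nu> :: real
  assumes "2 \<le> CARD('n)"
    and "-1 < \<nu>"
    and "1 < p" and "p < q"
  shows "(block_space q \<nu> :: (real ^ 'n::finite \<Rightarrow> complex) set) \<subset> block_space p \<nu>"
proof -
  let ?s = "sphere_measure :: (real ^ 'n) measure"
  have q: "1 < q" using assms by simp
  obtain P where P: "p = ennreal P" "1 < P" using ex_real_exponent[OF assms(3,4)] .
  have invp: "enn2real (inverse p) = 1 / P"
    using P by (simp add: inverse_ennreal divide_inverse)
  define \<gamma> where "\<gamma> = 1 / P - enn2real (inverse q)"
  have \<gamma>: "0 < \<gamma>"
  proof (cases q)
    case (real Q)
    then have "P < Q" using assms(4) P by (simp add: ennreal_less_iff)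
    then show ?thesis using real P by (simp add: \<gamma>_def inverse_ennreal divide_inverse)
  qed (use P in \<open>simp add: \<gamma>_def\<close>)
  obtain \<epsilon>0 c K :: real where \<epsilon>0: "0 < \<epsilon>0" and c: "0 < c" and K: "0 < K"
    and ex: "\<And>\<epsilon>. 0 < \<epsilon> \<Longrightarrow> \<epsilon> \<le> \<epsilon>0 \<Longrightarrow> \<exists>E. E \<in> sets ?s \<and>
       c * \<epsilon> \<le> measure ?s E \<and> measure ?s E \<le> K * \<epsilon> \<and>
       (\<forall>M a. is_cap M \<longrightarrow> is_block q M a \<longrightarrow> (\<integral>\<^sup>+ x\<in>E. ennreal (norm (a x)) \<partial>?s)
         \<le> ennreal (K * \<epsilon> powr (1 - enn2real (inverse q)) *
              (1 + log_plus (1 / measure ?s M) powr (1 + \<nu>))))"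
    using ex_block_test_set[OF assms(1,2) q] by blast
  \<comment> \<open>Small enough that the gain \<open>\<epsilon> i powr (- \<gamma>)\<close> is at
    least \<open>4 ^ i\<close>, which beats the coefficients \<open>(1/2) ^ i\<close>.\<close>
  define \<epsilon> where "\<epsilon> i = min \<epsilon>0 (((1/4) ^ i) powr (1 / \<gamma>))" for i :: nat
  have \<epsilon>: "0 < \<epsilon> i" "\<epsilon> i \<le> \<epsilon>0" for i using \<epsilon>0 by (auto simp: \<epsilon>_def)
  have \<epsilon>_small: "4 ^ i \<le> \<epsilon> i powr (- \<gamma>)" for i
  proof -
    have "\<epsilon> i powr \<gamma> \<le> (((1/4) ^ i) powr (1 / \<gamma>)) powr \<gamma>"
      using \<epsilon>[of i] \<gamma> by (intro powr_mono2) (auto simp: \<epsilon>_def)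
    also have "\<dots> = (1/4) ^ i" using \<gamma> by (simp add: powr_powr)
    finally show ?thesis using \<epsilon>[of i] by (simp add: powr_minus power_divide field_simps)
  qed
  have "\<exists>E. \<forall>i. E i \<in> sets ?s \<and> c * \<epsilon> i \<le> measure ?s (E i) \<and> measure ?s (E i) \<le> K * \<epsilon> i \<and>
       (\<forall>M a. is_cap M \<longrightarrow> is_block q M a \<longrightarrow> (\<integral>\<^sup>+ x\<in>E i. ennreal (norm (a x)) \<partial>?s)
         \<le> ennreal (K * \<epsilon> i powr (1 - enn2real (inverse q)) *
              (1 + log_plus (1 / measure ?s M) powr (1 + \<nu>))))"
    by (intro choice allI ex \<epsilon>)
  then obtain E where E [measurable]: "\<And>i. E i \<in> sets ?s"
    and lower: "\<And>i. c * \<epsilon> i \<le> measure ?s (E i)" and upper: "\<And>i. measure ?s (E i) \<le> K * \<epsilon> i"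
    and test: "\<And>i M a. is_cap M \<Longrightarrow> is_block q M a \<Longrightarrow> (\<integral>\<^sup>+ x\<in>E i. ennreal (norm (a x)) \<partial>?s)
         \<le> ennreal (K * \<epsilon> i powr (1 - enn2real (inverse q)) *
              (1 + log_plus (1 / measure ?s M) powr (1 + \<nu>)))"
    by blast
  \<comment> \<open>Normalises \<open>h i\<close> so that
    \<open>h i powr P * (K * \<epsilon> i)\<close> is exactly what a p-block on the whole sphere
    allows for the integral of its P-th power.\<close>
  define A where "A = measure ?s (sphere 0 1) powr (1 / P - 1) * K powr (- (1 / P))"
  define h where "h i = A * \<epsilon> i powr (- (1 / P))" for i
  have m0: "0 < measure ?s (sphere 0 1)" using measure_cap_pos[OF is_cap_sphere] .
  have A: "0 < A" using m0 K by (simp add: A_def)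
  have h: "0 < h i" for i using A \<epsilon>[of i] by (simp add: h_def)
  have block: "is_block p (sphere 0 1) (\<lambda>x. complex_of_real (h i * indicator (E i) x))" for i
  proof -
    have "(\<integral>\<^sup>+ x. ennreal (norm (complex_of_real (h i * indicator (E i) x)) powr P) \<partial>?s)
        = (\<integral>\<^sup>+ x. ennreal (h i powr P) * indicator (E i) x \<partial>?s)"
      using h[of i] by (intro nn_integral_cong) (auto split: split_indicator)
    also have "\<dots> = ennreal (h i powr P * measure ?s (E i))"
      by (simp add: nn_integral_cmult_indicator sphere.emeasure_eq_measure ennreal_mult)
    also have "\<dots> \<le> ennreal ((measure ?s (sphere 0 1) powr (1 / P - 1)) powr P)"
    proof (intro ennreal_leI)
      let ?m = "measure ?s (sphere 0 1) powr (1 / P - 1)"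
      have "h i = ?m * (K * \<epsilon> i) powr (- (1 / P))"
        using K \<epsilon>[of i] by (simp add: h_def A_def powr_mult)
      then have "h i powr P = ?m powr P * (K * \<epsilon> i) powr (-1)"
        using P K \<epsilon>[of i] by (simp add: powr_mult powr_powr)
      then have "h i powr P * (K * \<epsilon> i) = ?m powr P"
        using K \<epsilon>[of i] by (simp add: powr_minus field_simps)
      then show "h i powr P * measure ?s (E i) \<le> ?m powr P"
        using upper[of i] by (metis mult_left_mono powr_ge_zero)
    qed
    finally have "Lp_norm p ?s (\<lambda>x. complex_of_real (h i * indicator (E i) x))
        \<le> ennreal (measure ?s (sphere 0 1) powr (1 / P - 1))"
      unfolding P(1) using P by (intro Lp_norm_leI) auto
    moreover have "AE x in ?s. x \<in> sphere 0 1"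
      using AE_space[of ?s] by (simp add: space_sphere_measure)
    ultimately show ?thesis
      unfolding is_block_def enn2real_inverse_conjugate_exponent[OF assms(3)] invp
      by auto
  qed
  have nonneg: "0 \<le> h i * indicator (E i) x" for i x using h[of i] by simp
  obtain f where f: "f \<in> block_space p \<nu>"
    "AE x in ?s. \<forall>i. (1/2) ^ i * (h i * indicator (E i) x) \<le> norm (f x)"
    by (rule block_space_superposition[where b = "\<lambda>i x. h i * indicator (E i) x",
          OF assms(3) is_cap_sphere block nonneg])
  have "f \<notin> block_space q \<nu>"
  proof
    assume "f \<in> block_space q \<nu>"
    from block_space_integral_le[OF this]
    obtain S :: real where S: "0 \<le> S"
      and le: "\<And>F K. F \<in> sets ?s \<Longrightarrow> 0 \<le> K \<Longrightarrow>
      (\<And>M a. is_cap M \<Longrightarrow> is_block q M a \<Longrightarrow> (\<integral>\<^sup>+ x\<in>F. ennreal (norm (a x)) \<partial>?s)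
         \<le> ennreal (K * (1 + log_plus (1 / measure ?s M) powr (1 + \<nu>)))) \<Longrightarrow>
      (\<integral>\<^sup>+ x\<in>F. ennreal (norm (f x)) \<partial>?s) \<le> ennreal (K * S)" by blast
    \<comment> \<open>Compares the integral over \<open>E i\<close> of the i-th term, a lower bound
      for that of \<open>norm (f x)\<close>, with the bound valid in the q-space; the growth
      \<open>2 ^ i\<close> is what remains of \<open>4 ^ i\<close>.\<close>
    have "A * c * 2 ^ i \<le> K * S" for i
    proof -
      let ?\<beta> = "1 - enn2real (inverse q)"
      have "ennreal ((1/2) ^ i * h i * measure ?s (E i)) = (\<integral>\<^sup>+ x. ennreal ((1/2) ^ i * h i) * indicator (E i) x \<partial>?s)"
        using h[of i] by (simp add: nn_integral_cmult_indicator sphere.emeasure_eq_measure ennreal_mult)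
      also have "\<dots> \<le> (\<integral>\<^sup>+ x\<in>E i. ennreal (norm (f x)) \<partial>?s)"
      proof (rule nn_integral_mono_AE)
        show "AE x in ?s. ennreal ((1/2) ^ i * h i) * indicator (E i) x \<le> ennreal (norm (f x)) * indicator (E i) x"
          using f(2)
        proof eventually_elim
          case (elim x)
          then have "(1/2) ^ i * (h i * indicator (E i) x) \<le> norm (f x)" by blast
          then show ?case by (cases "x \<in> E i") (simp_all add: ennreal_leI)
        qed
      qed
      also have "\<dots> \<le> ennreal (K * \<epsilon> i powr ?\<beta> * S)"
        using K test by (intro le) auto
      finally have ub: "(1/2) ^ i * h i * measure ?s (E i) \<le> K * \<epsilon> i powr ?\<beta> * S"
        using K S by (subst (asm) ennreal_le_iff) auto
      have lb: "(1/2) ^ i * h i * (c * \<epsilon> i) \<le> (1/2) ^ i * h i * measure ?s (E i)"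
        using lower[of i] h[of i] by (intro mult_left_mono) auto
      \<comment> \<open>Since 1 - 1/P equals \<open>?\<beta> - \<gamma>\<close>, the power
        \<open>\<epsilon> i powr ?\<beta>\<close> of the upper bound splits off and cancels.\<close>
      have prod: "h i * \<epsilon> i = A * \<epsilon> i powr (- \<gamma>) * \<epsilon> i powr ?\<beta>"
        using powr_add[of "\<epsilon> i" "- (1/P)" 1] powr_add[of "\<epsilon> i" "- \<gamma>" ?\<beta>] \<epsilon>[of i]
        by (simp add: h_def \<gamma>_def)
      have lb_eq: "(1/2) ^ i * h i * (c * \<epsilon> i) = (1/2) ^ i * c * A * \<epsilon> i powr (- \<gamma>) * \<epsilon> i powr ?\<beta>"
      proof -
        have "(1/2) ^ i * h i * (c * \<epsilon> i) = (1/2) ^ i * c * (h i * \<epsilon> i)" by (simp only: mult_ac)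
        then show ?thesis unfolding prod by (simp only: mult.assoc)
      qed
      have ub_eq: "K * \<epsilon> i powr ?\<beta> * S = K * S * \<epsilon> i powr ?\<beta>" by (simp only: mult_ac)
      have "(1/2) ^ i * c * A * \<epsilon> i powr (- \<gamma>) * \<epsilon> i powr ?\<beta> \<le> K * S * \<epsilon> i powr ?\<beta>"
        using order_trans[OF lb ub] unfolding lb_eq ub_eq .
      then have "(1/2) ^ i * c * A * \<epsilon> i powr (- \<gamma>) \<le> K * S"
        using \<epsilon>[of i] by (simp add: mult_le_cancel_right)
      moreover have "(1/2) ^ i * c * A * 4 ^ i \<le> (1/2) ^ i * c * A * \<epsilon> i powr (- \<gamma>)"
        using \<epsilon>_small c A by (intro mult_left_mono) auto
      moreover have "(1/2) ^ i * c * A * 4 ^ i = A * c * 2 ^ i"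
        using power_mult_distrib[of "1/2::real" 4 i] by (simp add: mult_ac)
      ultimately show ?thesis by simp
    qed
    moreover obtain i where "K * S / (A * c) < 2 ^ i"
      using real_arch_pow[of 2 "K * S / (A * c)"] by auto
    then have "K * S < A * c * 2 ^ i" using A c by (simp add: field_simps)
    ultimately show False by (meson not_less)
  qed
  then show ?thesis using block_space_mono[OF assms(3,4)] f(1) by blast
qed

end
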